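(* Let $(X,d,f)$ be a TDS and $\varphi\in C(X,\mathbb R)$ with $\varphi>0$. Let $K\subset X$ be a non-empty compact subset. Then for every $\alpha\ge0$, $$\dim^\alpha_{BS}(f,K,\varphi)=\sup\{P^\alpha_\mu(f,\varphi):\mu\in\mathcal M(X),\ \mu(K)=1\}.$$
   Context: A TDS $(X,d,f)$ consists of a compact metric space $(X,d)$ and a continuous map $f:X\to X$; $\mathcal M(X)$ is the set of Borel probability measures on $X$. $S_n\varphi(x)=\sum_{j=0}^{n-1}\varphi(f^jx)$. For $\alpha\ge0$: $d_n^\alpha(x,y)=\max_{0\le i\le n-1}e^{\alpha i}d(f^ix,f^iy)$, $B_n^\alpha(x,\varepsilon)=\{y: d_n^\alpha(x,y)<\varepsilon\}$. $\alpha$-BS dimension: for $K\subset X$, $\varepsilon>0$, $s\ge0$, $n\in\mathbb N$, continuous $\varphi>0$, $M^\alpha(K,s,\varepsilon,n,\varphi)=\inf\sum_i\exp\big(-s\sup_{y\in B^\alpha_{n_i}(x_i,\varepsilon)}S_{n_i}\varphi(y)\big)$ over finite or countable families $\{B^\alpha_{n_i}(x_i,\varepsilon)\}$, $x_i\in X$, $n_i\ge n$, covering $K$; $M^\alpha(K,s,\varepsilon,\varphi)=\lim_n M^\alpha(K,s,\varepsilon,n,\varphi)$; $M^\alpha(K,\varepsilon,\varphi)=\inf\{s:M^\alpha(K,s,\varepsilon,\varphi)=0\}=\sup\{s:M^\alpha(K,s,\varepsilon,\varphi)=\infty\}$; $\dim^\alpha_{BS}(f,K,\varphi)=\lim_{\varepsilon\to0}M^\alpha(K,\varepsilon,\varphi)$.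 $\alpha$-local Brin–Katok entropy: for $\mu\in\mathcal M(X)$, $P^\alpha_\mu(f,x,\varphi)=\lim_{\varepsilon\to0}\liminf_{n\to\infty}\frac{-\log\mu(B_n^\alpha(x,\varepsilon))}{S_n\varphi(x)}$ and $P^\alpha_\mu(f,\varphi)=\int P^\alpha_\mu(f,x,\varphi)\,d\mu(x)$. *)

theory Defs
  imports "HOL-Probability.Probability"
begin

text \<open>The TDS is (UNIV :: 'a set, dist, f) with 'a a metric space type whose
  universe is compact, and f continuous.\<close>

definition birkhoff_sum :: "('a \<Rightarrow> 'a) \<Rightarrow> ('a \<Rightarrow> real) \<Rightarrow> nat \<Rightarrow> 'a \<Rightarrow> real" where
  "birkhoff_sum f \<phi> n x = (\<Sum>j<n. \<phi> ((f ^^ j) x))"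

definition alpha_bowen_ball :: "('a::metric_space \<Rightarrow> 'a) \<Rightarrow> real \<Rightarrow> nat \<Rightarrow> 'a \<Rightarrow> real \<Rightarrow> 'a set" where
  "alpha_bowen_ball f \<alpha> n x \<epsilon> =
     {y. \<forall>i<n. exp (\<alpha> * real i) * dist ((f ^^ i) x) ((f ^^ i) y) < \<epsilon>}"

definition M_alpha_n ::
  "('a::metric_space \<Rightarrow> 'a) \<Rightarrow> real \<Rightarrow> 'a set \<Rightarrow> real \<Rightarrow> real \<Rightarrow> nat \<Rightarrow> ('a \<Rightarrow> real) \<Rightarrow> ennreal" where
  "M_alpha_n f \<alpha> K s \<epsilon> n \<phi> =
     (INF (I, x, m) \<in> {(I :: nat set, x :: nat \<Rightarrow> 'a, m :: nat \<Rightarrow> nat).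
          (\<forall>i\<in>I. n \<le> m i) \<and> K \<subseteq> (\<Union>i\<in>I. alpha_bowen_ball f \<alpha> (m i) (x i) \<epsilon>)}.
        \<integral>\<^sup>+ i. ennreal (exp (- s * (SUP y \<in> alpha_bowen_ball f \<alpha> (m i) (x i) \<epsilon>.
                                         birkhoff_sum f \<phi> (m i) y))) \<partial>count_space I)"

definition M_alpha_s :: "('a::metric_space \<Rightarrow> 'a) \<Rightarrow> real \<Rightarrow> 'a set \<Rightarrow> real \<Rightarrow> real \<Rightarrow> ('a \<Rightarrow> real) \<Rightarrow> ennreal" where
  "M_alpha_s f \<alpha> K s \<epsilon> \<phi> = lim (\<lambda>n. M_alpha_n f \<alpha> K s \<epsilon> n \<phi>)"

definition M_alpha_eps :: "('a::metric_space \<Rightarrow> 'a) \<Rightarrow> real \<Rightarrow> 'a set \<Rightarrow> real \<Rightarrow> ('a \<Rightarrow> real) \<Rightarrow> ereal" where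
  "M_alpha_eps f \<alpha> K \<epsilon> \<phi> = Inf {ereal s | s. 0 \<le> s \<and> M_alpha_s f \<alpha> K s \<epsilon> \<phi> = 0}"

definition dim_BS_alpha :: "('a::metric_space \<Rightarrow> 'a) \<Rightarrow> real \<Rightarrow> 'a set \<Rightarrow> ('a \<Rightarrow> real) \<Rightarrow> ereal" where
  "dim_BS_alpha f \<alpha> K \<phi> = Lim (at_right 0) (\<lambda>\<epsilon>. M_alpha_eps f \<alpha> K \<epsilon> \<phi>)"

text \<open>alpha-local Brin--Katok entropy; -log 0 is read as +infinity.\<close>
definition local_BK_ratio ::
  "'a::metric_space measure \<Rightarrow> ('a \<Rightarrow> 'a) \<Rightarrow> real \<Rightarrow> ('a \<Rightarrow> real) \<Rightarrow> 'a \<Rightarrow> real \<Rightarrow> nat \<Rightarrow> ereal" where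
  "local_BK_ratio \<mu> f \<alpha> \<phi> x \<epsilon> n =
     (if measure \<mu> (alpha_bowen_ball f \<alpha> n x \<epsilon>) = 0 then \<infinity>
      else ereal (- ln (measure \<mu> (alpha_bowen_ball f \<alpha> n x \<epsilon>)) / birkhoff_sum f \<phi> n x))"

definition local_BK_entropy ::
  "'a::metric_space measure \<Rightarrow> ('a \<Rightarrow> 'a) \<Rightarrow> real \<Rightarrow> ('a \<Rightarrow> real) \<Rightarrow> 'a \<Rightarrow> ereal" where
  "local_BK_entropy \<mu> f \<alpha> \<phi> x =
     Lim (at_right 0) (\<lambda>\<epsilon>. liminf (\<lambda>n. local_BK_ratio \<mu> f \<alpha> \<phi> x \<epsilon> n))"

definition BK_entropy :: "'a::metric_space measure \<Rightarrow> ('a \<Rightarrow> 'a) \<Rightarrow> real \<Rightarrow> ('a \<Rightarrow> real) \<Rightarrow> ereal" where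
  "BK_entropy \<mu> f \<alpha> \<phi> = enn2ereal (\<integral>\<^sup>+ x. e2ennreal (local_BK_entropy \<mu> f \<alpha> \<phi> x) \<partial>\<mu>)"

end

theory Submission
  imports Defs
begin

text \<open>
  For the upper bound on the dimension, a positive value of the covering quantity is turned into a
  Frostman measure. Finitely additive probabilities on all subsets of the space form a compact set,
  so it suffices to satisfy finitely many constraints \<open>m (B j) \<le> e j\<close> at a time; by a least squares
  duality argument these can only fail if there is a cheap weighted cover of \<open>K\<close>. A weighted cover by
  Bowen balls of radius \<open>\<epsilon>\<close> yields an honest cover of radius \<open>2 * \<epsilon>\<close> at the price of an arbitrarily
  small increase of \<open>s\<close>. Finally, on a compact metric space a finitely additive probability dominates
  a Borel probability on all open sets, and Bowen balls are open.

  For the lower bound, if the local entropy exceeds \<open>s\<close> on a set that is not negligible, then the mass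
  distribution principle bounds the cost of every cover from below; uniform continuity of \<open>\<phi>\<close> together
  with \<open>S n x \<ge> n * min \<phi>\<close> makes the replacement of the supremum of \<open>S n\<close> over a ball by a value at one
  of its points harmless.
\<close>

section \<open>From finitely additive to Borel probabilities\<close>

definition fin_add_prob :: "('a set \<Rightarrow> real) \<Rightarrow> bool" where
  "fin_add_prob m \<longleftrightarrow>
     (\<forall>A. 0 \<le> m A) \<and> (\<forall>A B. A \<inter> B = {} \<longrightarrow> m (A \<union> B) = m A + m B) \<and> m UNIV = 1"

lemma fin_add_probD:
  assumes "fin_add_prob m"
  shows "0 \<le> m A" "A \<inter> B = {} \<Longrightarrow> m (A \<union> B) = m A + m B" "m UNIV = 1"
  using assms by (auto simp: fin_add_prob_def)

lemma fin_add_prob_mono: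
  assumes "fin_add_prob m" "A \<subseteq> B"
  shows "m A \<le> m B"
proof -
  have "B = A \<union> (B - A)" using assms by auto
  then have "m B = m A + m (B - A)"
    using fin_add_probD(2)[OF assms(1), of A "B - A"] by auto
  then show ?thesis using fin_add_probD(1)[OF assms(1), of "B - A"] by simp
qed

lemma fin_add_prob_subadd:
  assumes "fin_add_prob m"
  shows "m (A \<union> B) \<le> m A + m B"
proof -
  have "m (A \<union> (B - A)) = m A + m (B - A)"
    by (rule fin_add_probD(2)[OF assms]) auto
  moreover have "m (B - A) \<le> m B" by (rule fin_add_prob_mono[OF assms]) auto
  ultimately show ?thesis by simp
qed

lemma fin_add_prob_empty: "fin_add_prob m \<Longrightarrow> m {} = 0"
  using fin_add_probD(2)[of m "{}" "{}"] by simp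

text \<open>Normality separates the disjoint closed remainders \<open>C - U\<close> and
  \<open>C - V\<close> by open sets \<open>P\<close> and \<open>Q\<close>; removing \<open>P\<close>
  or \<open>Q\<close> from \<open>C\<close> leaves the two pieces.\<close>

lemma closed_split_open_cover:
  fixes C :: "'a::t4_space set"
  assumes "closed C" "open U" "open V" "C \<subseteq> U \<union> V"
  obtains C1 C2 where "closed C1" "closed C2" "C1 \<subseteq> U" "C2 \<subseteq> V" "C = C1 \<union> C2"
proof -
  have "closed (C - U)" "closed (C - V)" "(C - U) \<inter> (C - V) = {}"
    using assms by (auto intro: closed_Diff)
  from t4_space[OF this] obtain P Q where
    PQ: "open P" "open Q" "C - U \<subseteq> P" "C - V \<subseteq> Q" "P \<inter> Q = {}" by blast
  show ?thesis
    by (rule that[of "C - P" "C - Q"]) (use PQ assms in \<open>auto intro: closed_Diff\<close>)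
qed

text \<open>Approximation from inside by closed sets, which are compact in a compact space, is what
  turns finite additivity into countable subadditivity on open sets.\<close>

definition inner_content :: "('a::topological_space set \<Rightarrow> real) \<Rightarrow> 'a set \<Rightarrow> ennreal" where
  "inner_content m U = (SUP C \<in> {C. closed C \<and> C \<subseteq> U}. ennreal (m C))"

definition outer_content :: "('a::topological_space set \<Rightarrow> real) \<Rightarrow> 'a set \<Rightarrow> ennreal" where
  "outer_content m A = (INF U \<in> {U. open U \<and> A \<subseteq> U}. inner_content m U)"

lemma inner_content_mono: "U \<subseteq> V \<Longrightarrow> inner_content m U \<le> inner_content m V"
  unfolding inner_content_def by (rule SUP_subset_mono) auto

lemma inner_content_upper: "closed C \<Longrightarrow> C \<subseteq> U \<Longrightarrow> ennreal (m C) \<le> inner_content m U"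
  unfolding inner_content_def by (rule SUP_upper) auto

lemma outer_content_le: "open U \<Longrightarrow> A \<subseteq> U \<Longrightarrow> outer_content m A \<le> inner_content m U"
  unfolding outer_content_def by (rule INF_lower) auto

lemma outer_content_mono: "A \<subseteq> B \<Longrightarrow> outer_content m A \<le> outer_content m B"
  unfolding outer_content_def by (rule INF_superset_mono) auto

lemma outer_content_open:
  assumes "open U"
  shows "outer_content m U = inner_content m U"
proof (rule antisym)
  show "inner_content m U \<le> outer_content m U"
    unfolding outer_content_def by (rule INF_greatest) (auto intro: inner_content_mono)
qed (rule outer_content_le[OF assms order.refl])

lemma inner_content_le:
  assumes "fin_add_prob m"
  shows "inner_content m U \<le> ennreal (m U)"
  unfolding inner_content_def
  by (rule SUP_least) (auto intro!: ennreal_leI fin_add_prob_mono[OF assms])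

text \<open>Induction on the number of open sets: the part of \<open>C\<close> to be charged to the
  last one is split off as a closed set.\<close>

lemma inner_content_finite_cover:
  fixes U :: "nat \<Rightarrow> 'a::t4_space set"
  assumes m: "fin_add_prob m" and "\<And>i. open (U i)" "closed C" "C \<subseteq> (\<Union>i<n. U i)"
  shows "ennreal (m C) \<le> (\<Sum>i<n. inner_content m (U i))"
  using assms(3,4)
proof (induction n arbitrary: C)
  case 0
  then show ?case using fin_add_prob_empty[OF m] by simp
next
  case (Suc n)
  have "C \<subseteq> (\<Union>i<n. U i) \<union> U n" using Suc.prems(2) by (simp add: lessThan_Suc Un_commute)
  from closed_split_open_cover[OF \<open>closed C\<close> _ assms(2) this] obtain C1 C2 where
    C: "closed C1" "closed C2" "C1 \<subseteq> (\<Union>i<n. U i)" "C2 \<subseteq> U n" "C = C1 \<union> C2"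
    using assms(2) by blast
  have "ennreal (m C) \<le> ennreal (m C1 + m C2)"
    using fin_add_prob_subadd[OF m] C by (auto intro: ennreal_leI)
  also have "\<dots> = ennreal (m C1) + ennreal (m C2)"
    using fin_add_probD(1)[OF m] by simp
  also have "\<dots> \<le> (\<Sum>i<n. inner_content m (U i)) + inner_content m (U n)"
    by (intro add_mono Suc.IH inner_content_upper C)
  finally show ?case by simp
qed

lemma inner_content_countable_subadditive:
  fixes U :: "nat \<Rightarrow> 'a::metric_space set"
  assumes "compact (UNIV :: 'a set)" and m: "fin_add_prob m" and U: "\<And>i. open (U i)"
  shows "inner_content m (\<Union>i. U i) \<le> (\<Sum>i. inner_content m (U i))"
  unfolding inner_content_def[of m "\<Union>i. U i"]
proof (rule SUP_least, clarify)
  fix C assume C: "closed C" "C \<subseteq> (\<Union>i. U i)"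
  have "compact C" using closed_Int_compact[OF C(1) assms(1)] by simp
  from compactE_image[OF this, of UNIV U] U C(2) obtain J where J: "finite J" "C \<subseteq> (\<Union>i\<in>J. U i)"
    by auto
  obtain n where "J \<subseteq> {..<n}" using J(1) finite_nat_iff_bounded by blast
  then have "C \<subseteq> (\<Union>i<n. U i)" using J(2) by blast
  from inner_content_finite_cover[OF m U C(1) this]
  show "ennreal (m C) \<le> (\<Sum>i. inner_content m (U i))"
    by (rule order_trans) (auto intro: sum_le_suminf)
qed

lemma outer_content_lt_open:
  assumes "outer_content m A < b"
  obtains U where "open U" "A \<subseteq> U" "inner_content m U < b"
  using assms unfolding outer_content_def by (auto simp: INF_less_iff)

lemma outer_content_le_1:
  assumes "fin_add_prob m"
  shows "outer_content m A \<le> 1"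
proof -
  have "outer_content m A \<le> inner_content m UNIV" by (rule outer_content_le) auto
  also have "\<dots> \<le> ennreal (m UNIV)" by (rule inner_content_le[OF assms])
  finally show ?thesis using fin_add_probD(3)[OF assms] by simp
qed

lemma outer_measure_space_outer_content:
  fixes m :: "'a::metric_space set \<Rightarrow> real"
  assumes "compact (UNIV :: 'a set)" and m: "fin_add_prob m"
  shows "outer_measure_space (Pow UNIV) (outer_content m)"
  unfolding outer_measure_space_def
proof (intro conjI)
  have "outer_content m {} \<le> ennreal (m {})"
    using outer_content_le[of "{}" "{}" m] inner_content_le[OF m, of "{}"] by simp
  then show "positive (Pow UNIV) (outer_content m)"
    by (simp add: positive_def fin_add_prob_empty[OF m])
  show "increasing (Pow UNIV) (outer_content m)"
    by (auto simp: increasing_def intro: outer_content_mono)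
  show "countably_subadditive (Pow UNIV) (outer_content m)"
    unfolding countably_subadditive_def
  proof (intro allI impI, rule ennreal_le_epsilon)
    fix A :: "nat \<Rightarrow> 'a set" and e :: real
    assume "0 < e"
    have fin: "outer_content m (A i) < top" for i
      using outer_content_le_1[OF m, of "A i"] by (simp add: order_le_less_trans)
    \<comment> \<open>Since the outer content is finite, adding a positive amount makes it strictly
      larger, so an open superset fits in between. The amounts sum to \<open>e\<close>.\<close>
    have "\<exists>U. open U \<and> A i \<subseteq> U \<and> inner_content m U \<le> outer_content m (A i) + ennreal (e * (1/2) ^ Suc i)" for i
    proof -
      have "outer_content m (A i) < outer_content m (A i) + ennreal (e * (1/2) ^ Suc i)"
        using \<open>0 < e\<close> fin[of i] by (simp add: ennreal_add_left_cancel_less)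
      from outer_content_lt_open[OF this] obtain U where
        "open U" "A i \<subseteq> U" "inner_content m U < outer_content m (A i) + ennreal (e * (1/2) ^ Suc i)" .
      then show ?thesis by (intro exI[of _ U]) (simp add: less_imp_le)
    qed
    then obtain U where U: "\<And>i. open (U i)" "\<And>i. A i \<subseteq> U i"
      "\<And>i. inner_content m (U i) \<le> outer_content m (A i) + ennreal (e * (1/2) ^ Suc i)"
      by metis
    have "outer_content m (\<Union>i. A i) \<le> inner_content m (\<Union>i. U i)"
      using U by (intro outer_content_le) auto
    also have "\<dots> \<le> (\<Sum>i. inner_content m (U i))"
      by (rule inner_content_countable_subadditive[OF assms U(1)])
    also have "\<dots> \<le> (\<Sum>i. outer_content m (A i) + ennreal (e * (1/2) ^ Suc i))"
      by (intro suminf_le U) auto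
    also have "\<dots> = (\<Sum>i. outer_content m (A i)) + (\<Sum>i. ennreal (e * (1/2) ^ Suc i))"
      by (intro suminf_add[symmetric]) auto
    also have "(\<Sum>i. ennreal (e * (1/2) ^ Suc i)) = ennreal e"
      using \<open>0 < e\<close> sums_mult[OF power_half_series, of e]
      by (intro suminf_ennreal_eq) auto
    finally show "outer_content m (\<Union>i. A i) \<le> (\<Sum>i. outer_content m (A i)) + ennreal e" .
  qed
qed

text \<open>Exhaust \<open>U - F\<close> by closed sets \<open>D\<close> first. Then
  \<open>U - D\<close> is an open superset of \<open>U \<inter> F\<close>, and any closed
  \<open>E\<close> inside it is disjoint from \<open>D\<close>, so \<open>m D + m E\<close> is the
  value of \<open>m\<close> on a closed subset of \<open>U\<close>.\<close>

lemma inner_content_split_closed: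
  fixes U :: "'a::metric_space set"
  assumes m: "fin_add_prob m" and "open U" "closed F"
  shows "outer_content m (U \<inter> F) + outer_content m (U - F) \<le> inner_content m U"
proof -
  have *: "ennreal (m D) + outer_content m (U \<inter> F) \<le> inner_content m U"
    if D: "closed D" "D \<subseteq> U - F" for D
  proof -
    have "outer_content m (U \<inter> F) \<le> inner_content m (U - D)"
      using assms D by (intro outer_content_le) auto
    then have "ennreal (m D) + outer_content m (U \<inter> F) \<le> ennreal (m D) + inner_content m (U - D)"
      by (intro add_left_mono)
    also have "\<dots> = (SUP E \<in> {E. closed E \<and> E \<subseteq> U - D}. ennreal (m D) + ennreal (m E))"
      unfolding inner_content_def by (rule ennreal_SUP_add_right) (auto intro: exI[of _ "{}"])
    also have "\<dots> \<le> inner_content m U"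
    proof (rule SUP_least, clarify)
      fix E assume E: "closed E" "E \<subseteq> U - D"
      have "m (D \<union> E) = m D + m E"
        by (rule fin_add_probD(2)[OF m]) (use E in auto)
      then have "ennreal (m D) + ennreal (m E) = ennreal (m (D \<union> E))"
        using fin_add_probD(1)[OF m] by simp
      also have "\<dots> \<le> inner_content m U"
        using D E by (intro inner_content_upper) auto
      finally show "ennreal (m D) + ennreal (m E) \<le> inner_content m U" .
    qed
    finally show ?thesis .
  qed
  have eq: "outer_content m (U - F) = (SUP D \<in> {D. closed D \<and> D \<subseteq> U - F}. ennreal (m D))"
    using assms outer_content_open[of "U - F" m] by (simp add: inner_content_def open_Diff)
  have "outer_content m (U \<inter> F) + outer_content m (U - F)
      = (SUP D \<in> {D. closed D \<and> D \<subseteq> U - F}. outer_content m (U \<inter> F) + ennreal (m D))"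
    unfolding eq by (rule ennreal_SUP_add_right) (auto intro: exI[of _ "{}"])
  also have "\<dots> \<le> inner_content m U"
    by (rule SUP_least) (use * in \<open>auto simp: add.commute\<close>)
  finally show ?thesis .
qed

text \<open>The splitting inequality for open sets passes to an arbitrary test set \<open>A\<close>
  by taking the infimum over its open supersets; the other inequality is subadditivity.\<close>

lemma closed_in_lambda_system:
  fixes F :: "'a::metric_space set"
  assumes "compact (UNIV :: 'a set)" and m: "fin_add_prob m" and "closed F"
  shows "F \<in> lambda_system UNIV (Pow UNIV) (outer_content m)"
  unfolding lambda_system_def
proof (clarsimp, rule antisym)
  fix A :: "'a set"
  show "outer_content m (F \<inter> A) + outer_content m ((UNIV - F) \<inter> A) \<le> outer_content m A"
    unfolding outer_content_def[of m A]
  proof (rule INF_greatest, clarify)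
    fix U assume U: "open U" "A \<subseteq> U"
    have "outer_content m (F \<inter> A) + outer_content m ((UNIV - F) \<inter> A)
       \<le> outer_content m (U \<inter> F) + outer_content m (U - F)"
      using U by (intro add_mono outer_content_mono) auto
    also have "\<dots> \<le> inner_content m U"
      by (rule inner_content_split_closed[OF m U(1) assms(3)])
    finally show "outer_content m (F \<inter> A) + outer_content m ((UNIV - F) \<inter> A) \<le> inner_content m U" .
  qed
  have om: "outer_measure_space (Pow UNIV) (outer_content m)"
    by (rule outer_measure_space_outer_content[OF assms(1) m])
  interpret sigma_algebra "UNIV :: 'a set" "Pow UNIV" by (rule sigma_algebra_Pow)
  have "subadditive (Pow UNIV) (outer_content m)"
    using om unfolding outer_measure_space_def by (intro countably_subadditive_subadditive) auto
  from subadditiveD[OF this, of "F \<inter> A" "(UNIV - F) \<inter> A"]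
  have "outer_content m ((F \<inter> A) \<union> ((UNIV - F) \<inter> A)) \<le> outer_content m (F \<inter> A) + outer_content m ((UNIV - F) \<inter> A)"
    by auto
  moreover have "(F \<inter> A) \<union> ((UNIV - F) \<inter> A) = A" by auto
  ultimately show "outer_content m A \<le> outer_content m (F \<inter> A) + outer_content m ((UNIV - F) \<inter> A)"
    by simp
qed

text \<open>Closed sets are Caratheodory measurable, so the outer content restricts to a Borel
  measure. On an open set it is the inner content, a supremum of values of \<open>m\<close> on
  subsets.\<close>

proposition fin_add_prob_dominates_borel_prob:
  fixes m :: "'a::metric_space set \<Rightarrow> real"
  assumes "compact (UNIV :: 'a set)" and m: "fin_add_prob m"
  obtains \<mu> :: "'a measure" where "prob_space \<mu>" "sets \<mu> = sets borel"
    "\<And>U. open U \<Longrightarrow> measure \<mu> U \<le> m U"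
proof -
  let ?L = "lambda_system (UNIV :: 'a set) (Pow UNIV) (outer_content m)"
  have ms: "measure_space UNIV ?L (outer_content m)"
    by (rule sigma_algebra.caratheodory_lemma[OF sigma_algebra_Pow
          outer_measure_space_outer_content[OF assms]])
  then have sL: "sigma_algebra UNIV ?L" by (simp add: measure_space_def)
  have sub: "sets borel \<subseteq> ?L"
    unfolding borel_eq_closed
    using sigma_algebra.sigma_sets_subset[OF sL, of "Collect closed"]
      closed_in_lambda_system[OF assms] by auto
  have ms': "measure_space UNIV (sets borel) (outer_content m)"
    by (rule measure_down[OF ms _ sub]) (metis sets.sigma_algebra_axioms space_borel)
  define \<mu> where "\<mu> = measure_of UNIV (sets borel) (outer_content m)"
  have sets: "sets \<mu> = sets borel"
    unfolding \<mu>_def using sets.sigma_sets_eq[of "borel :: 'a measure"] by simp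
  have em: "emeasure \<mu> A = outer_content m A" if "A \<in> sets borel" for A
    using emeasure_measure_of_sigma[of UNIV "sets borel" "outer_content m" A] ms' that
    by (simp add: measure_space_def \<mu>_def)
  have sp: "space \<mu> = UNIV" using sets_eq_imp_space_eq[OF sets] by simp
  \<comment> \<open>No mass is lost, because \<open>UNIV\<close> is closed and competes in its own
    supremum.\<close>
  have "outer_content m UNIV = 1"
  proof (rule antisym[OF outer_content_le_1[OF m]])
    have "1 = ennreal (m UNIV)" using fin_add_probD(3)[OF m] by simp
    also have "\<dots> \<le> inner_content m UNIV" by (rule inner_content_upper) auto
    finally show "1 \<le> outer_content m UNIV" by (simp add: outer_content_open)
  qed
  then have prob: "prob_space \<mu>" by (intro prob_spaceI) (simp add: sp em)
  have "measure \<mu> U \<le> m U" if "open U" for U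
  proof -
    have "emeasure \<mu> U \<le> ennreal (m U)"
      using inner_content_le[OF m, of U] that by (simp add: em outer_content_open)
    then show ?thesis unfolding measure_def
      using enn2real_leI[OF fin_add_probD(1)[OF m]] by auto
  qed
  with prob sets show ?thesis by (rule that)
qed

section \<open>Finitely additive probabilities with prescribed upper bounds\<close>

lemma fin_add_prob_point: "fin_add_prob (\<lambda>A. indicator A x :: real)"
  by (auto simp: fin_add_prob_def indicator_def)

lemma fin_add_prob_convex:
  assumes "fin_add_prob m" "fin_add_prob m'" "0 \<le> t" "t \<le> 1"
  shows "fin_add_prob (\<lambda>A. (1 - t) * m A + t * m' A)"
  unfolding fin_add_prob_def
proof (intro conjI allI impI)
  show "0 \<le> (1 - t) * m A + t * m' A" for A
    using assms fin_add_probD(1) by (intro add_nonneg_nonneg mult_nonneg_nonneg) auto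
qed (simp_all add: fin_add_probD[OF assms(1)] fin_add_probD[OF assms(2)] algebra_simps)

text \<open>Tychonoff's theorem for the cube of functions into \<open>{0..1}\<close>; every defining
  condition is closed in the product topology.\<close>

lemma compact_fin_add_probs:
  "compact {m :: 'a set \<Rightarrow> real. fin_add_prob m \<and> m K = 1}" (is "compact ?P")
proof -
  have "compactin euclidean (PiE UNIV (\<lambda>_ :: 'a set. {0..1 :: real}))"
    by (subst euclidean_product_topology[symmetric], subst compactin_PiE) simp
  then have C: "compact (PiE UNIV (\<lambda>_ :: 'a set. {0..1 :: real}))"
    by simp
  have "closed {m :: 'a set \<Rightarrow> real. A \<inter> B = {} \<longrightarrow> m (A \<union> B) = m A + m B}" for A B
    by (cases "A \<inter> B = {}") (auto intro!: closed_Collect_eq continuous_intros)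
  moreover have "closed {m :: 'a set \<Rightarrow> real. 0 \<le> m A}" for A
    by (intro closed_Collect_le continuous_intros) simp
  moreover have "closed {m :: 'a set \<Rightarrow> real. m A = 1}" for A
    by (intro closed_Collect_eq continuous_intros) simp
  ultimately have "closed ?P"
    unfolding fin_add_prob_def by (intro closed_Collect_conj closed_Collect_all) auto
  moreover have "?P \<subseteq> PiE UNIV (\<lambda>_. {0..1})"
    using fin_add_prob_mono[of _ _ UNIV] by (auto simp: fin_add_prob_def PiE_def Pi_def)
  ultimately show ?thesis
    using closed_Int_compact[OF _ C, of ?P] by (simp add: Int_absorb2)
qed

text \<open>The hypothesis \<open>cover\<close> is the linear programming dual of the constraints:
  every weighted cover of \<open>K\<close> costs at least 1. The desired \<open>m\<close> is a least
  squares solution, which exists by compactness.\<close>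

lemma fin_add_prob_finite_constraints:
  fixes B :: "'j \<Rightarrow> 'a set" and e :: "'j \<Rightarrow> real"
  assumes J: "finite J" and "K \<noteq> {}"
    and cover: "\<And>y. (\<And>j. j \<in> J \<Longrightarrow> 0 \<le> y j) \<Longrightarrow>
      (\<And>x. x \<in> K \<Longrightarrow> 1 \<le> (\<Sum>j\<in>J. y j * indicator (B j) x)) \<Longrightarrow> 1 \<le> (\<Sum>j\<in>J. y j * e j)"
    and e: "\<And>j. j \<in> J \<Longrightarrow> 0 \<le> e j"
  obtains m where "fin_add_prob m" "m K = 1" "\<And>j. j \<in> J \<Longrightarrow> m (B j) \<le> e j"
proof -
  let ?P = "{m. fin_add_prob m \<and> m K = 1}"
  define F where "F m = (\<Sum>j\<in>J. (max 0 (m (B j) - e j))\<^sup>2)" for m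
  have "continuous_on ?P F"
    unfolding F_def
    by (intro continuous_intros continuous_on_subset[OF continuous_on_product_coordinates]) auto
  moreover have "?P \<noteq> {}"
    using \<open>K \<noteq> {}\<close> fin_add_prob_point by (fastforce simp: indicator_def)
  ultimately obtain m where m: "fin_add_prob m" "m K = 1"
    and min: "\<And>m'. fin_add_prob m' \<Longrightarrow> m' K = 1 \<Longrightarrow> F m \<le> F m'"
    using continuous_attains_inf[OF compact_fin_add_probs, of K F] by auto
  define y where "y j = max 0 (m (B j) - e j)" for j
  \<comment> \<open>Moving \<open>m\<close> towards the point mass at \<open>x \<in> K\<close> cannot decrease \<open>F\<close>, so the residuals \<open>y\<close> are, up to
    a scalar, a weighted cover of \<open>K\<close>; its cost would be too small if \<open>y\<close> did not vanish.\<close>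
  have y0: "0 \<le> y j" for j by (simp add: y_def)
  have first_order: "(\<Sum>j\<in>J. y j * m (B j)) \<le> (\<Sum>j\<in>J. y j * indicator (B j) x)" if "x \<in> K" for x
  proof (rule ccontr)
    define w where "w j = indicator (B j) x - m (B j)" for j
    define Y where "Y = (\<Sum>j\<in>J. y j * w j)"
    define W where "W = (\<Sum>j\<in>J. (w j)\<^sup>2)"
    assume "\<not> ?thesis"
    then have Y: "Y < 0"
      by (simp add: Y_def w_def right_diff_distrib sum_subtractf)
    have W: "0 \<le> W" by (simp add: W_def sum_nonneg)
    \<comment> \<open>The step length is small enough for \<open>t * W \<le> - Y\<close>, so the
      first order gain \<open>2 * Y\<close> beats the quadratic error. The summand 1 keeps the
      denominator positive.\<close>
    define t where "t = min 1 (- Y / (W + 1))"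
    have t: "0 < t" "t \<le> 1" using Y W by (auto simp: t_def divide_neg_pos)
    have "t * W \<le> (- Y / (W + 1)) * W" using W by (intro mult_right_mono) (auto simp: t_def)
    also have "\<dots> \<le> - Y" using Y W by (simp add: field_simps)
    finally have tW: "t * W \<le> - Y" .
    let ?m = "\<lambda>A. (1 - t) * m A + t * indicator A x"
    have "fin_add_prob ?m"
      using fin_add_prob_convex[OF m(1) fin_add_prob_point, of t x] t by simp
    moreover have "?m K = 1" using m(2) that by simp
    ultimately have "F m \<le> F ?m" by (rule min)
    also have "F ?m \<le> (\<Sum>j\<in>J. (y j + t * w j)\<^sup>2)"
      unfolding F_def
    proof (rule sum_mono)
      fix j assume "j \<in> J"
      have "(1 - t) * m (B j) + t * indicator (B j) x - e j = (m (B j) - e j) + t * w j"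
        by (simp add: w_def algebra_simps)
      \<comment> \<open>Truncating before adding \<open>u\<close> can only raise the value, since
        \<open>v \<le> max 0 v\<close>; so the positive part of \<open>v + u\<close> is at most
        \<open>\<bar>max 0 v + u\<bar>\<close>.\<close>
      moreover have "(max 0 (v + u))\<^sup>2 \<le> (max 0 v + u)\<^sup>2" for u v :: real
        by (rule abs_le_square_iff[THEN iffD1]) auto
      ultimately show "(max 0 ((1 - t) * m (B j) + t * indicator (B j) x - e j))\<^sup>2 \<le> (y j + t * w j)\<^sup>2"
        unfolding y_def by (simp only:)
    qed
    also have "\<dots> = F m + t * (2 * Y + t * W)"
      by (simp add: F_def y_def[symmetric] Y_def W_def power2_sum sum.distrib sum_distrib_left
          algebra_simps power2_eq_square)
    finally have "0 \<le> 2 * Y + t * W" using t by (simp add: zero_le_mult_iff)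
    with tW Y show False by simp
  qed
  define q where "q = (\<Sum>j\<in>J. (y j)\<^sup>2)"
  define b where "b = (\<Sum>j\<in>J. y j * m (B j))"
  \<comment> \<open>Termwise, \<open>y j * (m (B j) - e j)\<close> is the square of
    \<open>y j\<close>. If \<open>q\<close> were positive, \<open>y / b\<close> would be a weighted
    cover of cost below 1.\<close>
  have b: "b = q + (\<Sum>j\<in>J. y j * e j)"
    unfolding b_def q_def sum.distrib[symmetric]
    by (rule sum.cong) (auto simp: y_def max_def power2_eq_square algebra_simps)
  have "m (B j) \<le> e j" if "j \<in> J" for j
  proof (rule ccontr)
    assume "\<not> ?thesis"
    then have "0 < (y j)\<^sup>2" by (simp add: y_def)
    then have "0 < q" unfolding q_def using J that by (intro sum_pos2[of J j]) auto
    moreover have "0 \<le> (\<Sum>j\<in>J. y j * e j)" using e y0 by (intro sum_nonneg mult_nonneg_nonneg)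
    ultimately have "0 < b" by (simp add: b)
    have "1 \<le> (\<Sum>j\<in>J. (y j / b) * e j)"
    proof (rule cover)
      show "1 \<le> (\<Sum>j\<in>J. y j / b * indicator (B j) x)" if "x \<in> K" for x
        using first_order[OF that] \<open>0 < b\<close>
        by (simp add: b_def[symmetric] sum_divide_distrib[symmetric])
    qed (use y0 \<open>0 < b\<close> in auto)
    also have "\<dots> = (\<Sum>j\<in>J. y j * e j) / b" by (simp add: sum_divide_distrib)
    finally show False using \<open>0 < b\<close> \<open>0 < q\<close> b by simp
  qed
  with m show ?thesis by (rule that)
qed

text \<open>Each constraint is a closed condition on a compact set, so the finite intersection
  property reduces an arbitrary index set to finite ones.\<close>

proposition fin_add_prob_constraints:
  fixes B :: "'j \<Rightarrow> 'a set" and e :: "'j \<Rightarrow> real"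
  assumes "K \<noteq> {}"
    and e: "\<And>j. j \<in> J \<Longrightarrow> 0 \<le> e j"
    and cover: "\<And>I y. finite I \<Longrightarrow> I \<subseteq> J \<Longrightarrow> (\<And>j. j \<in> I \<Longrightarrow> 0 \<le> y j) \<Longrightarrow>
      (\<And>x. x \<in> K \<Longrightarrow> 1 \<le> (\<Sum>j\<in>I. y j * indicator (B j) x)) \<Longrightarrow> 1 \<le> (\<Sum>j\<in>I. y j * e j)"
  obtains m where "fin_add_prob m" "m K = 1" "\<And>j. j \<in> J \<Longrightarrow> m (B j) \<le> e j"
proof -
  have "{m. fin_add_prob m \<and> m K = 1} \<inter> (\<Inter>j\<in>J. {m. m (B j) \<le> e j}) \<noteq> {}"
  proof (rule compact_imp_fip_image[OF compact_fin_add_probs])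
    show "closed {m. m (B j) \<le> e j}" for j
      by (intro closed_Collect_le continuous_intros) simp
    fix I assume I: "finite I" "I \<subseteq> J"
    obtain m where "fin_add_prob m" "m K = 1" "\<And>j. j \<in> I \<Longrightarrow> m (B j) \<le> e j"
      by (rule fin_add_prob_finite_constraints[OF I(1) \<open>K \<noteq> {}\<close>, of B e])
        (use cover[OF I] e I in blast)+
    then show "{m. fin_add_prob m \<and> m K = 1} \<inter> (\<Inter>j\<in>I. {m. m (B j) \<le> e j}) \<noteq> {}"
      by blast
  qed
  then show ?thesis using that by blast
qed

section \<open>Bowen balls and covering quantities\<close>

text \<open>Both limits in the radius are monotone, so they exist and can be handled as suprema from
  here on.\<close>

lemma Lim_at_right_antimono:
  fixes g :: "real \<Rightarrow> ereal"
  assumes "\<And>a b. 0 < a \<Longrightarrow> a \<le> b \<Longrightarrow> g b \<le> g a"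
  shows "Lim (at_right 0) g = (SUP \<epsilon>\<in>{0<..}. g \<epsilon>)"
proof (rule tendsto_Lim)
  show "(g \<longlongrightarrow> (SUP \<epsilon>\<in>{0<..}. g \<epsilon>)) (at_right 0)"
  proof (rule order_tendstoI)
    fix a assume "a < (SUP \<epsilon>\<in>{0<..}. g \<epsilon>)"
    then obtain e where e: "0 < e" "a < g e" by (auto simp: less_SUP_iff)
    have "\<forall>\<^sub>F x in at_right 0. x \<in> {0<..<e}" by (rule eventually_at_right_real[OF e(1)])
    then show "\<forall>\<^sub>F x in at_right 0. a < g x"
      by eventually_elim (use assms e(2) in \<open>fastforce intro: less_le_trans\<close>)
  next
    fix a assume a: "(SUP \<epsilon>\<in>{0<..}. g \<epsilon>) < a"
    have "\<forall>\<^sub>F x in at_right (0::real). x \<in> {0<..<1}" by (rule eventually_at_right_real) simp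
    then show "\<forall>\<^sub>F x in at_right 0. g x < a"
      by eventually_elim (use a in \<open>auto intro: le_less_trans[OF SUP_upper]\<close>)
  qed
qed simp

lemma M_alpha_n_le:
  fixes I :: "nat set"
  assumes "\<forall>i\<in>I. n \<le> m i" "K \<subseteq> (\<Union>i\<in>I. alpha_bowen_ball f \<alpha> (m i) (x i) \<epsilon>)"
  shows "M_alpha_n f \<alpha> K s \<epsilon> n \<phi> \<le>
    (\<integral>\<^sup>+ i. ennreal (exp (- s * (SUP y \<in> alpha_bowen_ball f \<alpha> (m i) (x i) \<epsilon>.
                                         birkhoff_sum f \<phi> (m i) y))) \<partial>count_space I)"
  unfolding M_alpha_n_def by (rule INF_lower2[of "(I, x, m)"]) (use assms in auto)

lemma M_alpha_n_greatest:
  assumes "\<And>(I :: nat set) x m. \<forall>i\<in>I. n \<le> m i \<Longrightarrow> K \<subseteq> (\<Union>i\<in>I. alpha_bowen_ball f \<alpha> (m i) (x i) \<epsilon>) \<Longrightarrow>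
    c \<le> (\<integral>\<^sup>+ i. ennreal (exp (- s * (SUP y \<in> alpha_bowen_ball f \<alpha> (m i) (x i) \<epsilon>.
                                         birkhoff_sum f \<phi> (m i) y))) \<partial>count_space I)"
  shows "c \<le> M_alpha_n f \<alpha> K s \<epsilon> n \<phi>"
  unfolding M_alpha_n_def by (rule INF_greatest, clarify, rule assms) auto

lemma M_alpha_n_mono: "n \<le> n' \<Longrightarrow> M_alpha_n f \<alpha> K s \<epsilon> n \<phi> \<le> M_alpha_n f \<alpha> K s \<epsilon> n' \<phi>"
  by (rule M_alpha_n_greatest, rule M_alpha_n_le) (auto intro: order_trans)

lemma M_alpha_s_eq_SUP: "M_alpha_s f \<alpha> K s \<epsilon> \<phi> = (SUP n. M_alpha_n f \<alpha> K s \<epsilon> n \<phi>)"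
  unfolding M_alpha_s_def
  by (intro limI LIMSEQ_SUP) (auto simp: mono_def intro: M_alpha_n_mono)

lemma M_alpha_eps_nonneg: "0 \<le> M_alpha_eps f \<alpha> K \<epsilon> \<phi>"
  unfolding M_alpha_eps_def by (rule Inf_greatest) auto

text \<open>The set \<open>A\<close> may be non-measurable; intersecting open supersets of measure
  below \<open>1 / Suc n\<close> encloses it in a measurable null set.\<close>

lemma subset_null_set_of_small_open:
  fixes A :: "'a::topological_space set"
  assumes sets: "sets \<mu> = sets borel"
    and small: "\<And>d :: ennreal. 0 < d \<Longrightarrow> \<exists>U. open U \<and> A \<subseteq> U \<and> emeasure \<mu> U < d"
  obtains G where "G \<in> null_sets \<mu>" "A \<subseteq> G"
proof -
  have "\<forall>n. \<exists>U. open U \<and> A \<subseteq> U \<and> emeasure \<mu> U < ennreal (1 / Suc n)"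
    using small by simp
  then obtain U where U: "\<And>n. open (U n)" "\<And>n. A \<subseteq> U n"
    "\<And>n. emeasure \<mu> (U n) < ennreal (1 / Suc n)" by metis
  have s: "U n \<in> sets \<mu>" for n using U(1) by (simp add: sets)
  have "emeasure \<mu> (\<Inter>n. U n) = 0"
  proof (rule antisym)
    have "emeasure \<mu> (\<Inter>n. U n) \<le> ennreal (1 / Suc n)" for n
      using emeasure_mono[OF _ s, of "\<Inter>n. U n" n] U(3)[of n] by force
    moreover have "(\<lambda>n. ennreal (1 / Suc n)) \<longlonglongrightarrow> ennreal 0"
      by (intro tendsto_ennrealI LIMSEQ_Suc[OF lim_1_over_n])
    ultimately show "emeasure \<mu> (\<Inter>n. U n) \<le> 0"
      by (metis LIMSEQ_le_const ennreal_0)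
  qed simp
  then have "(\<Inter>n. U n) \<in> null_sets \<mu>"
    using s by (intro null_setsI sets.countable_INT') auto
  then show ?thesis using U(2) by (intro that[of "\<Inter>n. U n"]) auto
qed

lemma e2ennreal_ereal_nonneg: "0 \<le> s \<Longrightarrow> e2ennreal (ereal s) = ennreal s"
  by (metis e2ennreal_enn2ereal enn2ereal_ennreal)

section \<open>Birkhoff sums and Bowen balls on a compact system\<close>

locale alpha_system =
  fixes f :: "'a::metric_space \<Rightarrow> 'a" and \<phi> :: "'a \<Rightarrow> real" and \<alpha> :: real
  assumes compact_UNIV: "compact (UNIV :: 'a set)"
    and continuous_f: "continuous_on UNIV f"
    and continuous_phi: "continuous_on UNIV \<phi>"
    and phi_pos: "0 < \<phi> x"
    and alpha_nonneg: "0 \<le> \<alpha>"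
begin

abbreviation S :: "nat \<Rightarrow> 'a \<Rightarrow> real" where
  "S \<equiv> birkhoff_sum f \<phi>"

abbreviation B :: "nat \<Rightarrow> 'a \<Rightarrow> real \<Rightarrow> 'a set" where
  "B \<equiv> alpha_bowen_ball f \<alpha>"

definition S_sup :: "nat \<Rightarrow> 'a \<Rightarrow> real \<Rightarrow> real" where
  "S_sup n x \<epsilon> = (SUP y \<in> B n x \<epsilon>. S n y)"

definition phi_min :: real where
  "phi_min = (INF x. \<phi> x)"

text \<open>By compactness the infimum is attained, hence positive. The resulting linear growth of
  \<open>S n\<close> lets an error proportional to \<open>n\<close> be absorbed by a small change of
  exponent.\<close>

lemma phi_min_pos: "0 < phi_min" and phi_min_le: "phi_min \<le> \<phi> x"
proof -
  obtain z where z: "\<And>x. \<phi> z \<le> \<phi> x"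
    using continuous_attains_inf[OF compact_UNIV _ continuous_phi] by auto
  then have "phi_min = \<phi> z"
    unfolding phi_min_def by (intro cInf_eq_minimum) auto
  with z phi_pos[of z] show "0 < phi_min" "phi_min \<le> \<phi> x" by auto
qed

lemma continuous_iterate: "continuous_on UNIV (f ^^ i)"
proof (induction i)
  case (Suc i)
  then show ?case
    using continuous_on_compose[OF Suc continuous_on_subset[OF continuous_f]]
    by (simp add: comp_def)
qed (simp add: id_def)

lemma continuous_S: "continuous_on UNIV (S n)"
  unfolding birkhoff_sum_def
  by (intro continuous_intros continuous_on_compose2[OF continuous_phi continuous_iterate]) auto

lemma S_ge: "phi_min * n \<le> S n x"
  using sum_mono[of "{..<n}" "\<lambda>_. phi_min" "\<lambda>j. \<phi> ((f ^^ j) x)"] phi_min_le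
  by (simp add: birkhoff_sum_def mult.commute)

lemma bdd_above_S: "bdd_above (S n ` A)"
proof -
  have "compact (S n ` UNIV)"
    by (rule compact_continuous_image[OF continuous_S compact_UNIV])
  then have "bdd_above (S n ` UNIV)"
    by (intro bounded_imp_bdd_above compact_imp_bounded)
  then show ?thesis by (rule bdd_above_mono) auto
qed

lemma mem_B_self: "0 < \<epsilon> \<Longrightarrow> x \<in> B n x \<epsilon>"
  by (simp add: alpha_bowen_ball_def)

lemma mem_B_dist:
  assumes "y \<in> B n x \<epsilon>" "i < n"
  shows "dist ((f ^^ i) x) ((f ^^ i) y) < \<epsilon>"
proof -
  have "1 * dist ((f ^^ i) x) ((f ^^ i) y) \<le> exp (\<alpha> * real i) * dist ((f ^^ i) x) ((f ^^ i) y)"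
    using alpha_nonneg by (intro mult_right_mono) auto
  also have "\<dots> < \<epsilon>" using assms by (simp add: alpha_bowen_ball_def)
  finally show ?thesis by simp
qed

lemma open_B: "open (B n x \<epsilon>)"
proof -
  have "B n x \<epsilon> = (\<Inter>i<n. {y. exp (\<alpha> * real i) * dist ((f ^^ i) x) ((f ^^ i) y) < \<epsilon>})"
    by (auto simp: alpha_bowen_ball_def)
  moreover have "open {y. exp (\<alpha> * real i) * dist ((f ^^ i) x) ((f ^^ i) y) < \<epsilon>}" for i
    by (intro open_Collect_less continuous_intros continuous_iterate)
  ultimately show ?thesis by auto
qed

lemma B_mono: "\<epsilon> \<le> \<epsilon>' \<Longrightarrow> B n x \<epsilon> \<subseteq> B n x \<epsilon>'"
  by (fastforce simp: alpha_bowen_ball_def)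

text \<open>The triangle inequality for the weighted orbit distance: a ball may be recentred at any
  of its points if the radius is doubled.\<close>

lemma B_subset_double:
  assumes "z \<in> B n x \<epsilon>"
  shows "B n x \<epsilon> \<subseteq> B n z (2 * \<epsilon>)"
proof
  fix y assume y: "y \<in> B n x \<epsilon>"
  have "exp (\<alpha> * real i) * dist ((f ^^ i) z) ((f ^^ i) y) < 2 * \<epsilon>" if "i < n" for i
  proof -
    have "exp (\<alpha> * real i) * dist ((f ^^ i) z) ((f ^^ i) y)
        \<le> exp (\<alpha> * real i) * (dist ((f ^^ i) x) ((f ^^ i) z) + dist ((f ^^ i) x) ((f ^^ i) y))"
      by (intro mult_left_mono dist_triangle3) auto
    also have "\<dots> < 2 * \<epsilon>"
      using assms y that unfolding alpha_bowen_ball_def distrib_left by fastforce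
    finally show ?thesis .
  qed
  then show "y \<in> B n z (2 * \<epsilon>)" by (simp add: alpha_bowen_ball_def)
qed

lemma S_le_S_sup: "0 < \<epsilon> \<Longrightarrow> S n x \<le> S_sup n x \<epsilon>"
  unfolding S_sup_def by (rule cSUP_upper[OF mem_B_self bdd_above_S])

lemma S_sup_mono: "0 < \<epsilon> \<Longrightarrow> B n x \<epsilon> \<subseteq> B n z \<epsilon>' \<Longrightarrow> S_sup n x \<epsilon> \<le> S_sup n z \<epsilon>'"
  unfolding S_sup_def using mem_B_self[of \<epsilon> x n] by (intro cSUP_subset_mono bdd_above_S) auto

lemma S_sup_ge: "0 < \<epsilon> \<Longrightarrow> phi_min * n \<le> S_sup n x \<epsilon>"
  using S_ge[of n x] S_le_S_sup[of \<epsilon> n x] by simp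

section \<open>Monotonicity in the radius\<close>

lemma M_alpha_n_antimono_eps:
  assumes "0 \<le> s" "0 < \<epsilon>" "\<epsilon> \<le> \<epsilon>'"
  shows "M_alpha_n f \<alpha> K s \<epsilon>' n \<phi> \<le> M_alpha_n f \<alpha> K s \<epsilon> n \<phi>"
proof (rule M_alpha_n_greatest)
  fix I :: "nat set" and x m assume *: "\<forall>i\<in>I. n \<le> m i" "K \<subseteq> (\<Union>i\<in>I. B (m i) (x i) \<epsilon>)"
  \<comment> \<open>Enlarging the radius with the same centres keeps the cover and raises each
    supremum of \<open>S\<close>, so every term becomes cheaper as \<open>0 \<le> s\<close>.\<close>
  have "K \<subseteq> (\<Union>i\<in>I. B (m i) (x i) \<epsilon>')"
    by (rule order_trans[OF *(2)]) (intro UN_mono order.refl B_mono assms)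
  then have "M_alpha_n f \<alpha> K s \<epsilon>' n \<phi>
      \<le> (\<integral>\<^sup>+ i. ennreal (exp (- s * S_sup (m i) (x i) \<epsilon>')) \<partial>count_space I)"
    unfolding S_sup_def by (rule M_alpha_n_le[OF *(1)])
  also have "\<dots> \<le> (\<integral>\<^sup>+ i. ennreal (exp (- s * S_sup (m i) (x i) \<epsilon>)) \<partial>count_space I)"
    by (intro nn_integral_mono ennreal_leI) (simp add: mult_left_mono S_sup_mono B_mono assms)
  finally show "M_alpha_n f \<alpha> K s \<epsilon>' n \<phi> \<le> (\<integral>\<^sup>+ i. ennreal (exp (- s * (SUP y \<in> B (m i) (x i) \<epsilon>. S (m i) y))) \<partial>count_space I)"
    unfolding S_sup_def .
qed

lemma M_alpha_eps_antimono:
  assumes "0 < \<epsilon>" "\<epsilon> \<le> \<epsilon>'"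
  shows "M_alpha_eps f \<alpha> K \<epsilon>' \<phi> \<le> M_alpha_eps f \<alpha> K \<epsilon> \<phi>"
proof -
  have "M_alpha_s f \<alpha> K s \<epsilon>' \<phi> \<le> M_alpha_s f \<alpha> K s \<epsilon> \<phi>" if "0 \<le> s" for s
    unfolding M_alpha_s_eq_SUP
    by (rule SUP_mono) (use M_alpha_n_antimono_eps[OF that assms] in blast)
  then show ?thesis
    unfolding M_alpha_eps_def by (intro Inf_superset_mono) (auto, metis le_zero_eq)
qed

lemma dim_BS_alpha_eq_SUP: "dim_BS_alpha f \<alpha> K \<phi> = (SUP \<epsilon>\<in>{0<..}. M_alpha_eps f \<alpha> K \<epsilon> \<phi>)"
  unfolding dim_BS_alpha_def by (rule Lim_at_right_antimono) (rule M_alpha_eps_antimono)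

lemma local_BK_ratio_antimono:
  assumes "prob_space \<mu>" "sets \<mu> = sets borel" "\<epsilon> \<le> \<epsilon>'"
  shows "local_BK_ratio \<mu> f \<alpha> \<phi> x \<epsilon>' n \<le> local_BK_ratio \<mu> f \<alpha> \<phi> x \<epsilon> n"
proof -
  interpret prob_space \<mu> by fact
  have "measure \<mu> (B n x \<epsilon>) \<le> measure \<mu> (B n x \<epsilon>')"
    by (intro finite_measure_mono B_mono assms) (simp add: assms open_B)
  \<comment> \<open>Strict positivity fails for \<open>n = 0\<close>, where both quotients are 0 by
    the convention for division by zero.\<close>
  moreover have "0 \<le> S n x" using S_ge[of n x] phi_min_pos
    by (meson less_imp_le mult_nonneg_nonneg of_nat_0_le_iff order_trans)
  ultimately show ?thesis
  proof (cases "measure \<mu> (B n x \<epsilon>) = 0")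
    case False
    assume le: "measure \<mu> (B n x \<epsilon>) \<le> measure \<mu> (B n x \<epsilon>')" and S: "0 \<le> S n x"
    have pos: "0 < measure \<mu> (B n x \<epsilon>)" using False by (simp add: zero_less_measure_iff)
    then have "- ln (measure \<mu> (B n x \<epsilon>')) / S n x \<le> - ln (measure \<mu> (B n x \<epsilon>)) / S n x"
      using le S by (intro divide_right_mono) auto
    then show ?thesis using pos le by (simp add: local_BK_ratio_def)
  qed (simp add: local_BK_ratio_def)
qed

lemma local_BK_entropy_eq_SUP:
  assumes "prob_space \<mu>" "sets \<mu> = sets borel"
  shows "local_BK_entropy \<mu> f \<alpha> \<phi> x = (SUP \<epsilon>\<in>{0<..}. liminf (local_BK_ratio \<mu> f \<alpha> \<phi> x \<epsilon>))"
  unfolding local_BK_entropy_def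
  by (rule Lim_at_right_antimono) (intro Liminf_mono always_eventually allI local_BK_ratio_antimono assms)

text \<open>Covers in \<open>M_alpha_n\<close> are indexed by sets of natural numbers; a finite set
  of pairs of order and centre is enumerated to fit that format.\<close>

lemma M_alpha_n_le_finite:
  assumes "finite T" "\<And>n z. (n, z) \<in> T \<Longrightarrow> N \<le> n" "K \<subseteq> (\<Union>(n, z)\<in>T. B n z \<epsilon>)"
  shows "M_alpha_n f \<alpha> K s \<epsilon> N \<phi> \<le> ennreal (\<Sum>(n, z)\<in>T. exp (- s * S_sup n z \<epsilon>))"
proof -
  obtain h where h: "bij_betw h {0..<card T} T"
    using ex_bij_betw_nat_finite[OF assms(1)] by blast
  then have img: "h ` {0..<card T} = T" by (rule bij_betw_imp_surj_on)
  let ?g = "\<lambda>p. exp (- s * S_sup (fst p) (snd p) \<epsilon>)"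
  have "M_alpha_n f \<alpha> K s \<epsilon> N \<phi>
      \<le> (\<integral>\<^sup>+ i. ennreal (?g (h i)) \<partial>count_space {0..<card T})"
    unfolding S_sup_def
  proof (rule M_alpha_n_le)
    show "\<forall>i\<in>{0..<card T}. N \<le> fst (h i)"
      using assms(2) img by (metis imageI prod.collapse)
    have "(\<Union>i\<in>{0..<card T}. B (fst (h i)) (snd (h i)) \<epsilon>) = (\<Union>p\<in>h ` {0..<card T}. B (fst p) (snd p) \<epsilon>)"
      by simp
    then show "K \<subseteq> (\<Union>i\<in>{0..<card T}. B (fst (h i)) (snd (h i)) \<epsilon>)"
      using assms(3) unfolding img by (simp add: case_prod_beta)
  qed
  also have "\<dots> = ennreal (\<Sum>i\<in>{0..<card T}. ?g (h i))"
    by (simp add: nn_integral_count_space_finite sum_ennreal)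
  also have "(\<Sum>i\<in>{0..<card T}. ?g (h i)) = (\<Sum>p\<in>T. ?g p)"
    by (rule sum.reindex_bij_betw[OF h])
  finally show ?thesis by (simp add: case_prod_beta)
qed

subsection \<open>Weighted covers and Frostman measures\<close>

text \<open>A maximal set \<open>Z\<close> meeting each ball of a weighted cover at most once pays its total mass only
  once. This replaces the covering lemma of the usual argument.\<close>

lemma level_cover:
  assumes X: "finite X" and y: "\<And>x. x \<in> X \<Longrightarrow> 0 \<le> y x" and "0 \<le> s" "0 < \<epsilon>" "0 \<le> t"
    and A: "\<And>z. z \<in> A \<Longrightarrow> t < (\<Sum>x\<in>X. y x * indicator (B n x \<epsilon>) z)"
  obtains Z where "finite Z" "A \<subseteq> (\<Union>z\<in>Z. B n z (2 * \<epsilon>))"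
    "t * (\<Sum>z\<in>Z. exp (- s * S_sup n z (2 * \<epsilon>))) \<le> (\<Sum>x\<in>X. y x * exp (- s * S_sup n x \<epsilon>))"
proof -
  define sep where "sep Z \<longleftrightarrow> Z \<subseteq> A \<and> finite Z \<and>
    (\<forall>x\<in>X. \<forall>z\<in>Z. \<forall>w\<in>Z. z \<in> B n x \<epsilon> \<longrightarrow> w \<in> B n x \<epsilon> \<longrightarrow> z = w)" for Z
  have ball: "\<exists>x\<in>X. z \<in> B n x \<epsilon>" if "z \<in> A" for z
  proof (rule ccontr)
    assume "\<not> ?thesis"
    then have "(\<Sum>x\<in>X. y x * indicator (B n x \<epsilon>) z) = 0" by (intro sum.neutral) auto
    with A[OF that] \<open>0 \<le> t\<close> show False by simp
  qed
  \<comment> \<open>Choosing for each point of \<open>Z\<close> a ball containing it is injective by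
    separation. The bound on the cardinality guarantees that a largest separated set exists.\<close>
  have card: "card Z \<le> card X" if "sep Z" for Z
  proof -
    have "Z \<subseteq> A" using that by (simp add: sep_def)
    then have "\<forall>z\<in>Z. \<exists>x. x \<in> X \<and> z \<in> B n x \<epsilon>" using ball by blast
    from bchoice[OF this] obtain g where g: "\<forall>z\<in>Z. g z \<in> X \<and> z \<in> B n (g z) \<epsilon>" ..
    have "inj_on g Z"
    proof (rule inj_onI)
      fix z w assume zw: "z \<in> Z" "w \<in> Z" "g z = g w"
      then have "g z \<in> X" "z \<in> B n (g z) \<epsilon>" "w \<in> B n (g z) \<epsilon>" using g by auto
      then show "z = w" using zw(1,2) that by (simp add: sep_def)
    qed
    then show ?thesis using g X by (intro card_inj_on_le[of g]) auto
  qed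
  have "sep {}" by (simp add: sep_def)
  moreover have "\<forall>Z. sep Z \<longrightarrow> card Z < Suc (card X)" using card by (simp add: less_Suc_eq_le)
  ultimately obtain Z where Z: "sep Z" and max: "\<And>Z'. sep Z' \<Longrightarrow> card Z' \<le> card Z"
    using ex_has_greatest_nat[of sep "{}" card "Suc (card X)"] by auto
  then have fin: "finite Z" and ZA: "Z \<subseteq> A" by (auto simp: sep_def)
  \<comment> \<open>By maximality a point of \<open>A\<close> outside \<open>Z\<close> shares some
    ball of radius \<open>\<epsilon>\<close> with a point \<open>z\<close> of \<open>Z\<close>,
    hence lies in the doubled ball around \<open>z\<close>.\<close>
  have cov: "A \<subseteq> (\<Union>z\<in>Z. B n z (2 * \<epsilon>))"
  proof
    fix w assume w: "w \<in> A"
    show "w \<in> (\<Union>z\<in>Z. B n z (2 * \<epsilon>))"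
    proof (cases "w \<in> Z")
      case True
      then show ?thesis using mem_B_self[of "2 * \<epsilon>" w n] \<open>0 < \<epsilon>\<close> by auto
    next
      case False
      then have "card (insert w Z) = Suc (card Z)" using fin by simp
      then have "\<not> sep (insert w Z)" using max[of "insert w Z"] by auto
      then obtain x z where "z \<in> Z" "z \<in> B n x \<epsilon>" "w \<in> B n x \<epsilon>"
        using Z w fin unfolding sep_def by auto
      then show ?thesis using B_subset_double by blast
    qed
  qed
  let ?d = "\<lambda>z. exp (- s * S_sup n z (2 * \<epsilon>))" and ?c = "\<lambda>x. exp (- s * S_sup n x \<epsilon>)"
  have dc: "?d z \<le> ?c x" if "z \<in> B n x \<epsilon>" for x z
    using S_sup_mono[OF \<open>0 < \<epsilon>\<close> B_subset_double[OF that]] \<open>0 \<le> s\<close> by (simp add: mult_left_mono)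
  have one: "(\<Sum>z\<in>Z. indicator (B n x \<epsilon>) z :: real) \<le> 1" if "x \<in> X" for x
  proof -
    have "(\<Sum>z\<in>Z. indicator (B n x \<epsilon>) z :: real) = card (Z \<inter> B n x \<epsilon>)"
      using fin by (simp add: indicator_def sum.If_cases)
    moreover have "card (Z \<inter> B n x \<epsilon>) \<le> Suc 0"
      using Z that fin unfolding sep_def by (subst card_le_Suc0_iff_eq) auto
    ultimately show ?thesis by simp
  qed
  have "t * (\<Sum>z\<in>Z. ?d z) = (\<Sum>z\<in>Z. t * ?d z)" by (simp add: sum_distrib_left)
  \<comment> \<open>Double counting: each \<open>z\<close> has total weight above \<open>t\<close>
    and charges its cost to the balls containing it; by \<open>dc\<close> the charge to a ball is at
    most that ball's own cost. After swapping the sums, \<open>one\<close> says that each ball is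
    charged at most once.\<close>
  also have "\<dots> \<le> (\<Sum>z\<in>Z. \<Sum>x\<in>X. y x * ?c x * indicator (B n x \<epsilon>) z)"
  proof (rule sum_mono)
    fix z assume "z \<in> Z"
    then have "t * ?d z \<le> (\<Sum>x\<in>X. y x * indicator (B n x \<epsilon>) z) * ?d z"
      using A[of z] ZA by (intro mult_right_mono) auto
    also have "\<dots> = (\<Sum>x\<in>X. y x * indicator (B n x \<epsilon>) z * ?d z)" by (simp add: sum_distrib_right)
    also have "\<dots> \<le> (\<Sum>x\<in>X. y x * ?c x * indicator (B n x \<epsilon>) z)"
      using dc y by (intro sum_mono) (auto simp: indicator_def intro!: mult_left_mono)
    finally show "t * ?d z \<le> (\<Sum>x\<in>X. y x * ?c x * indicator (B n x \<epsilon>) z)" .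
  qed
  also have "\<dots> = (\<Sum>x\<in>X. (y x * ?c x) * (\<Sum>z\<in>Z. indicator (B n x \<epsilon>) z))"
    by (subst sum.swap) (simp add: sum_distrib_left)
  also have "\<dots> \<le> (\<Sum>x\<in>X. (y x * ?c x) * 1)"
    using y one by (intro sum_mono mult_left_mono) auto
  finally have "t * (\<Sum>z\<in>Z. ?d z) \<le> (\<Sum>x\<in>X. y x * ?c x)" by simp
  with fin cov show ?thesis by (rule that)
qed

text \<open>The weights are sorted by order \<open>n\<close> and level \<open>n\<close> gets the
  threshold \<open>?r ^ n\<close>. The thresholds sum to less than 1, so every point of
  \<open>K\<close> exceeds one of them and is caught by \<open>level_cover\<close>. The loss
  \<open>1 / ?r ^ n\<close> there is paid by the extra exponent \<open>\<delta>\<close>.\<close>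

lemma M_alpha_n_le_weighted:
  assumes I: "finite I" "\<And>n x. (n, x) \<in> I \<Longrightarrow> N \<le> n" and y: "\<And>p. p \<in> I \<Longrightarrow> 0 \<le> y p"
    and cover: "\<And>z. z \<in> K \<Longrightarrow> 1 \<le> (\<Sum>p\<in>I. y p * indicator (B (fst p) (snd p) \<epsilon>) z)"
    and s: "0 \<le> s" and \<delta>: "0 < \<delta>" and \<epsilon>: "0 < \<epsilon>"
    and tail: "\<And>n. (\<Sum>k\<in>{N..<n}. exp (- \<delta> * phi_min) ^ k) < 1"
  shows "M_alpha_n f \<alpha> K (s + \<delta>) (2 * \<epsilon>) N \<phi>
    \<le> ennreal (\<Sum>p\<in>I. y p * exp (- s * S_sup (fst p) (snd p) \<epsilon>))"
proof -
  let ?r = "exp (- \<delta> * phi_min)"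
  let ?D = "fst ` I"
  let ?X = "\<lambda>n. I `` {n}"
  let ?w = "\<lambda>n z. \<Sum>x\<in>?X n. y (n, x) * indicator (B n x \<epsilon>) z"
  have finX: "finite (?X n)" for n
    using I(1) by (rule finite_Image)
  have I_eq: "I = Sigma ?D ?X" by force
  have split: "(\<Sum>p\<in>I. g p) = (\<Sum>n\<in>?D. \<Sum>x\<in>?X n. g (n, x))" for g :: "_ \<Rightarrow> real"
  proof -
    have "(\<Sum>n\<in>?D. \<Sum>x\<in>?X n. g (n, x)) = (\<Sum>p\<in>Sigma ?D ?X. g p)"
      by (subst sum.Sigma) (use I(1) finX in auto)
    then show ?thesis unfolding I_eq[symmetric] by (rule sym)
  qed
  let ?Q = "\<lambda>n Z. finite Z \<and> {z. ?r ^ n < ?w n z} \<subseteq> (\<Union>z\<in>Z. B n z (2 * \<epsilon>)) \<and>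
      ?r ^ n * (\<Sum>z\<in>Z. exp (- s * S_sup n z (2 * \<epsilon>))) \<le> (\<Sum>x\<in>?X n. y (n, x) * exp (- s * S_sup n x \<epsilon>))"
  have "\<exists>Z. ?Q n Z" for n
    by (rule level_cover[OF finX[of n], of "\<lambda>x. y (n, x)" s \<epsilon> "?r ^ n" "{z. ?r ^ n < ?w n z}" n])
      (use y s \<epsilon> in auto)
  then have "\<exists>Z. \<forall>n. ?Q n (Z n)" by (intro choice allI)
  then obtain Z where "\<forall>n. ?Q n (Z n)" ..
  then have Z: "\<And>n. finite (Z n)" "\<And>n. {z. ?r ^ n < ?w n z} \<subseteq> (\<Union>z\<in>Z n. B n z (2 * \<epsilon>))"
    "\<And>n. ?r ^ n * (\<Sum>z\<in>Z n. exp (- s * S_sup n z (2 * \<epsilon>))) \<le> (\<Sum>x\<in>?X n. y (n, x) * exp (- s * S_sup n x \<epsilon>))"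
    by blast+
  have "M_alpha_n f \<alpha> K (s + \<delta>) (2 * \<epsilon>) N \<phi>
    \<le> ennreal (\<Sum>(n, z)\<in>Sigma ?D Z. exp (- (s + \<delta>) * S_sup n z (2 * \<epsilon>)))"
  proof (rule M_alpha_n_le_finite)
    show "finite (Sigma ?D Z)" using I(1) Z(1) by auto
    show "N \<le> n" if "(n, z) \<in> Sigma ?D Z" for n z using that I(2) by auto
    show "K \<subseteq> (\<Union>(n, z)\<in>Sigma ?D Z. B n z (2 * \<epsilon>))"
    proof
      fix w assume w: "w \<in> K"
      have "\<exists>n\<in>?D. ?r ^ n < ?w n w"
      proof (rule ccontr)
        assume neg: "\<not> ?thesis"
        obtain m where "?D \<subseteq> {..<m}" using I(1) finite_nat_iff_bounded by blast
        then have D: "?D \<subseteq> {N..<m}" using I(2) by force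
        have "1 \<le> (\<Sum>n\<in>?D. ?w n w)" using cover[OF w] by (simp add: split)
        also have "\<dots> \<le> (\<Sum>n\<in>?D. ?r ^ n)" using neg by (intro sum_mono) force
        also have "\<dots> \<le> (\<Sum>n\<in>{N..<m}. ?r ^ n)" by (rule sum_mono2[OF _ D]) auto
        finally show False using tail[of m] by simp
      qed
      then obtain n where n: "n \<in> ?D" "?r ^ n < ?w n w" by blast
      then obtain z where "z \<in> Z n" "w \<in> B n z (2 * \<epsilon>)" using Z(2)[of n] by blast
      then show "w \<in> (\<Union>(n, z)\<in>Sigma ?D Z. B n z (2 * \<epsilon>))" using n(1) by auto
    qed
  qed
  also have "\<dots> \<le> ennreal (\<Sum>p\<in>I. y p * exp (- s * S_sup (fst p) (snd p) \<epsilon>))"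
  proof (rule ennreal_leI)
    \<comment> \<open>The surplus factor
      \<open>exp (- \<delta> * S_sup n z (2 * \<epsilon>))\<close> is at most \<open>?r ^ n\<close>,
      because \<open>S_sup\<close> is at least \<open>phi_min * n\<close>.\<close>
    have "exp (- (s + \<delta>) * S_sup n z (2 * \<epsilon>)) \<le> ?r ^ n * exp (- s * S_sup n z (2 * \<epsilon>))" for n z
    proof -
      have "\<delta> * (phi_min * n) \<le> \<delta> * S_sup n z (2 * \<epsilon>)"
        using S_sup_ge[of "2 * \<epsilon>" n z] \<epsilon> \<delta> by (intro mult_left_mono) auto
      then have "- (s + \<delta>) * S_sup n z (2 * \<epsilon>) \<le> n * (- \<delta> * phi_min) + (- s * S_sup n z (2 * \<epsilon>))"
        by (simp add: algebra_simps)
      then show ?thesis by (simp only: exp_of_nat_mult[symmetric] exp_add[symmetric] exp_le_cancel_iff)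
    qed
    then have "(\<Sum>(n, z)\<in>Sigma ?D Z. exp (- (s + \<delta>) * S_sup n z (2 * \<epsilon>)))
      \<le> (\<Sum>(n, z)\<in>Sigma ?D Z. ?r ^ n * exp (- s * S_sup n z (2 * \<epsilon>)))"
      by (intro sum_mono) (simp only: case_prod_beta)
    also have "\<dots> = (\<Sum>n\<in>?D. ?r ^ n * (\<Sum>z\<in>Z n. exp (- s * S_sup n z (2 * \<epsilon>))))"
      using I(1) Z(1) by (subst sum.Sigma[symmetric]) (auto simp: sum_distrib_left)
    also have "\<dots> \<le> (\<Sum>n\<in>?D. \<Sum>x\<in>?X n. y (n, x) * exp (- s * S_sup n x \<epsilon>))"
      by (intro sum_mono Z(3))
    also have "\<dots> = (\<Sum>p\<in>I. y p * exp (- s * S_sup (fst p) (snd p) \<epsilon>))" by (simp add: split)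
    finally show "(\<Sum>(n, z)\<in>Sigma ?D Z. exp (- (s + \<delta>) * S_sup n z (2 * \<epsilon>)))
      \<le> (\<Sum>p\<in>I. y p * exp (- s * S_sup (fst p) (snd p) \<epsilon>))" .
  qed
  finally show ?thesis .
qed

text \<open>The bounds \<open>?e\<close> are the ball costs divided by a positive lower bound
  \<open>\<gamma>\<close> of the covering quantity, so the comparison of weighted and honest covers
  is exactly the dual condition required for a content.\<close>

lemma frostman_measure:
  assumes K: "closed K" "K \<noteq> {}" and s: "0 \<le> s" and \<delta>: "0 < \<delta>" and \<epsilon>: "0 < \<epsilon>"
    and pos: "M_alpha_s f \<alpha> K (s + \<delta>) (2 * \<epsilon>) \<phi> \<noteq> 0"
  obtains \<mu> :: "'a measure" and C N where "prob_space \<mu>" "sets \<mu> = sets borel" "measure \<mu> K = 1"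
    "0 < C" "\<And>n x. N \<le> n \<Longrightarrow> measure \<mu> (B n x \<epsilon>) \<le> C * exp (- s * S n x)"
proof -
  let ?r = "exp (- \<delta> * phi_min)"
  obtain n0 where n0: "M_alpha_n f \<alpha> K (s + \<delta>) (2 * \<epsilon>) n0 \<phi> \<noteq> 0"
  proof (rule ccontr)
    assume "\<not> thesis"
    with that have "M_alpha_n f \<alpha> K (s + \<delta>) (2 * \<epsilon>) n \<phi> = 0" for n by blast
    then show False using pos by (simp add: M_alpha_s_eq_SUP)
  qed
  have "?r < 1" using \<delta> phi_min_pos by simp
  then have "summable (\<lambda>k. ?r ^ k)" by (intro summable_geometric) simp
  then obtain n1 where n1: "\<And>m n. n1 \<le> m \<Longrightarrow> norm (sum (\<lambda>k. ?r ^ k) {m..<n}) < 1"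
    unfolding summable_Cauchy by (metis zero_less_one)
  \<comment> \<open>Beyond \<open>n0\<close> the covering quantity is nonzero, and beyond
    \<open>n1\<close> the geometric thresholds sum to less than 1.\<close>
  define N where "N = max n0 n1"
  have tail: "(\<Sum>k\<in>{N..<n}. ?r ^ k) < 1" for n
    using n1[of N n] by (simp add: N_def)
  have "0 < M_alpha_n f \<alpha> K (s + \<delta>) (2 * \<epsilon>) N \<phi>"
    using n0 M_alpha_n_mono[of n0 N f \<alpha> K "s + \<delta>" "2 * \<epsilon>" \<phi>]
    by (simp add: N_def zero_less_iff_neq_zero) (metis le_zero_eq)
  \<comment> \<open>The covering quantity may be infinite; a value strictly below it is a finite
    number \<open>\<gamma>\<close> by which one can divide.\<close>
  then obtain c where c: "0 < c" "c < M_alpha_n f \<alpha> K (s + \<delta>) (2 * \<epsilon>) N \<phi>"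
    using dense by blast
  then obtain \<gamma> where \<gamma>: "0 < \<gamma>" "c = ennreal \<gamma>"
    by (cases c) (auto simp: ennreal_zero_less_top)
  let ?J = "{N..} \<times> (UNIV :: 'a set)"
  let ?e = "\<lambda>p. exp (- s * S_sup (fst p) (snd p) \<epsilon>) / \<gamma>"
  obtain m where m: "fin_add_prob m" "m K = 1"
    "\<And>p. p \<in> ?J \<Longrightarrow> m (B (fst p) (snd p) \<epsilon>) \<le> ?e p"
  proof (rule fin_add_prob_constraints[OF K(2), of ?J ?e "\<lambda>p. B (fst p) (snd p) \<epsilon>"])
    fix I :: "(nat \<times> 'a) set" and y :: "nat \<times> 'a \<Rightarrow> real"
    assume I: "finite I" "I \<subseteq> ?J" and y: "\<And>p. p \<in> I \<Longrightarrow> 0 \<le> y p"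
      and cover: "\<And>z. z \<in> K \<Longrightarrow> 1 \<le> (\<Sum>p\<in>I. y p * indicator (B (fst p) (snd p) \<epsilon>) z)"
    let ?c = "\<Sum>p\<in>I. y p * exp (- s * S_sup (fst p) (snd p) \<epsilon>)"
    have "ennreal \<gamma> \<le> M_alpha_n f \<alpha> K (s + \<delta>) (2 * \<epsilon>) N \<phi>" using c \<gamma> by simp
    also have "\<dots> \<le> ennreal ?c"
      using I by (intro M_alpha_n_le_weighted y cover s \<delta> \<epsilon> tail) auto
    finally have "\<gamma> \<le> ?c" using y by (simp add: ennreal_le_iff sum_nonneg)
    then show "1 \<le> (\<Sum>p\<in>I. y p * ?e p)"
      using \<gamma>(1) by (simp add: sum_divide_distrib[symmetric])
  qed (use \<gamma>(1) in auto)
  obtain \<mu> :: "'a measure" where \<mu>: "prob_space \<mu>" "sets \<mu> = sets borel"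
    "\<And>U. open U \<Longrightarrow> measure \<mu> U \<le> m U"
    by (rule fin_add_prob_dominates_borel_prob[OF compact_UNIV m(1)]) blast
  interpret prob_space \<mu> by fact
  have sp: "space \<mu> = UNIV" using sets_eq_imp_space_eq[OF \<mu>(2)] by simp
  \<comment> \<open>The domination of \<open>\<mu>\<close> by \<open>m\<close> is known on open sets
    only, so full mass of \<open>K\<close> is deduced from its open complement.\<close>
  have "m (- K) = 0"
    using fin_add_probD(2)[OF m(1), of K "- K"] fin_add_probD(3)[OF m(1)] m(2) by simp
  then have "measure \<mu> (- K) = 0"
    using \<mu>(3)[of "- K"] K(1) measure_nonneg[of \<mu> "- K"] by (simp add: open_Compl)
  then have K1: "measure \<mu> K = 1"
    using prob_compl[of "- K"] K(1) by (simp add: sp \<mu>(2) borel_closed Compl_eq_Diff_UNIV[symmetric])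
  have "measure \<mu> (B n x \<epsilon>) \<le> 1 / \<gamma> * exp (- s * S n x)" if "N \<le> n" for n x
  proof -
    have "measure \<mu> (B n x \<epsilon>) \<le> m (B n x \<epsilon>)" by (rule \<mu>(3)[OF open_B])
    also have "\<dots> \<le> exp (- s * S_sup n x \<epsilon>) / \<gamma>" using m(3)[of "(n, x)"] that by simp
    also have "\<dots> \<le> exp (- s * S n x) / \<gamma>"
      using \<gamma>(1) s S_le_S_sup[OF \<epsilon>, of n x] by (intro divide_right_mono) (auto intro: mult_left_mono)
    finally show ?thesis by simp
  qed
  then show ?thesis using \<mu> K1 \<gamma>(1) by (intro that[of \<mu> "1 / \<gamma>" N]) auto
qed

section \<open>Entropy of Frostman measures and the upper bound on the dimension\<close>

lemma local_BK_entropy_ge: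
  assumes \<mu>: "prob_space \<mu>" "sets \<mu> = sets borel" and "0 < \<epsilon>" "0 < C"
    and le: "\<And>n. N \<le> n \<Longrightarrow> measure \<mu> (B n x \<epsilon>) \<le> C * exp (- s * S n x)"
  shows "ereal s \<le> local_BK_entropy \<mu> f \<alpha> \<phi> x"
proof -
  have "ereal s \<le> liminf (local_BK_ratio \<mu> f \<alpha> \<phi> x \<epsilon>)"
    unfolding le_Liminf_iff
  proof (intro allI impI)
    fix a :: ereal assume "a < ereal s"
    then obtain s' where s': "a < ereal s'" "s' < s" using ereal_dense2 by force
    \<comment> \<open>From \<open>n1\<close> on, the constant \<open>ln C\<close> is absorbed by the
      gap between \<open>s'\<close> and \<open>s\<close>, as \<open>S n x\<close> grows at least
      like \<open>phi_min * n\<close>.\<close>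
    obtain n1 :: nat where n1: "ln C / ((s - s') * phi_min) < n1" using reals_Archimedean2 by blast
    have "a < local_BK_ratio \<mu> f \<alpha> \<phi> x \<epsilon> n" if n: "N \<le> n" "n1 \<le> n" "1 \<le> n" for n
    proof (cases "measure \<mu> (B n x \<epsilon>) = 0")
      case True
      then show ?thesis using s'(1) by (auto simp: local_BK_ratio_def intro: less_le_trans)
    next
      case False
      then have p: "0 < measure \<mu> (B n x \<epsilon>)" by (simp add: zero_less_measure_iff)
      have "0 < phi_min * n" using n phi_min_pos by simp
      then have S: "0 < S n x" using S_ge[of n x] by linarith
      have "ln C / ((s - s') * phi_min) \<le> n" using n1 n by linarith
      then have "ln C \<le> (s - s') * (phi_min * n)"
        using s' phi_min_pos by (simp add: field_simps)
      also have "\<dots> \<le> (s - s') * S n x" using s' S_ge by (intro mult_left_mono) auto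
      finally have C: "ln C \<le> (s - s') * S n x" .
      have "ln (measure \<mu> (B n x \<epsilon>)) \<le> ln (C * exp (- s * S n x))"
        using p le[OF n(1)] \<open>0 < C\<close> by (subst ln_le_cancel_iff) auto
      also have "\<dots> = ln C - s * S n x" using \<open>0 < C\<close> by (simp add: ln_mult)
      finally have "s' * S n x \<le> - ln (measure \<mu> (B n x \<epsilon>))" using C by (simp add: algebra_simps)
      then have "s' \<le> - ln (measure \<mu> (B n x \<epsilon>)) / S n x" by (subst pos_le_divide_eq[OF S])
      then show ?thesis using False s'(1)
        by (auto simp: local_BK_ratio_def intro: less_le_trans)
    qed
    then show "\<forall>\<^sub>F n in sequentially. a < local_BK_ratio \<mu> f \<alpha> \<phi> x \<epsilon> n"
      unfolding eventually_sequentially by (intro exI[of _ "max N (max n1 1)"]) auto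
  qed
  also have "\<dots> \<le> local_BK_entropy \<mu> f \<alpha> \<phi> x"
    unfolding local_BK_entropy_eq_SUP[OF \<mu>] using \<open>0 < \<epsilon>\<close> by (intro SUP_upper) auto
  finally show ?thesis .
qed

lemma BK_entropy_ge:
  assumes "prob_space \<mu>" "0 \<le> s" "\<And>x. ereal s \<le> local_BK_entropy \<mu> f \<alpha> \<phi> x"
  shows "ereal s \<le> BK_entropy \<mu> f \<alpha> \<phi>"
proof -
  interpret prob_space \<mu> by fact
  have "ennreal s = (\<integral>\<^sup>+ x. ennreal s \<partial>\<mu>)" by (simp add: emeasure_space_1)
  also have "\<dots> \<le> (\<integral>\<^sup>+ x. e2ennreal (local_BK_entropy \<mu> f \<alpha> \<phi> x) \<partial>\<mu>)"
    using e2ennreal_mono[OF assms(3)] assms(2)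
    by (intro nn_integral_mono) (simp add: e2ennreal_ereal_nonneg)
  finally show ?thesis
    using assms(2) unfolding BK_entropy_def less_eq_ennreal.rep_eq by (simp add: enn2ereal_ennreal)
qed

lemma dim_BS_alpha_le:
  assumes K: "compact K" "K \<noteq> {}"
  shows "dim_BS_alpha f \<alpha> K \<phi> \<le>
    (SUP \<mu> \<in> {\<mu> :: 'a measure. prob_space \<mu> \<and> sets \<mu> = sets borel \<and> measure \<mu> K = 1}.
        BK_entropy \<mu> f \<alpha> \<phi>)" (is "_ \<le> ?R")
proof (rule ccontr)
  assume "\<not> ?thesis"
  then have lt: "?R < dim_BS_alpha f \<alpha> K \<phi>" by simp
  obtain z where z: "z \<in> K" using K(2) by blast
  \<comment> \<open>A point mass in \<open>K\<close> shows that the supremum is nonnegative, which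
    makes the exponent \<open>s\<close> chosen above it nonnegative too.\<close>
  have "0 \<le> BK_entropy (return borel z) f \<alpha> \<phi>" by (simp add: BK_entropy_def)
  also have "\<dots> \<le> ?R"
    using z compact_imp_closed[OF K(1)]
    by (intro SUP_upper) (simp add: prob_space_return measure_return borel_closed)
  finally have R0: "0 \<le> ?R" .
  obtain \<epsilon>' where \<epsilon>': "0 < \<epsilon>'" "?R < M_alpha_eps f \<alpha> K \<epsilon>' \<phi>"
    using lt by (auto simp: dim_BS_alpha_eq_SUP less_SUP_iff)
  obtain s where s: "?R < ereal s" "ereal s < M_alpha_eps f \<alpha> K \<epsilon>' \<phi>" using \<epsilon>'(2) ereal_dense2 by blast
  \<comment> \<open>The gap \<open>s' - s\<close> plays the role of \<open>\<delta>\<close> in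
    \<open>frostman_measure\<close>, and halving the radius compensates for the doubling
    there.\<close>
  obtain s' where s': "ereal s < ereal s'" "ereal s' < M_alpha_eps f \<alpha> K \<epsilon>' \<phi>" using s(2) ereal_dense2 by blast
  have s0: "0 \<le> s" using le_less_trans[OF R0 s(1)] by simp
  define \<epsilon> where "\<epsilon> = \<epsilon>' / 2"
  have \<epsilon>: "0 < \<epsilon>" "2 * \<epsilon> = \<epsilon>'" using \<epsilon>'(1) by (auto simp: \<epsilon>_def)
  have ne: "M_alpha_s f \<alpha> K (s + (s' - s)) (2 * \<epsilon>) \<phi> \<noteq> 0"
  proof
    assume "M_alpha_s f \<alpha> K (s + (s' - s)) (2 * \<epsilon>) \<phi> = 0"
    then have "M_alpha_eps f \<alpha> K \<epsilon>' \<phi> \<le> ereal s'"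
      unfolding M_alpha_eps_def using s0 s'(1) \<epsilon>(2) by (intro Inf_lower) auto
    then show False using s'(2) by simp
  qed
  obtain \<mu> :: "'a measure" and C N where \<mu>: "prob_space \<mu>" "sets \<mu> = sets borel" "measure \<mu> K = 1"
    "0 < C" "\<And>n x. N \<le> n \<Longrightarrow> measure \<mu> (B n x \<epsilon>) \<le> C * exp (- s * S n x)"
    using frostman_measure[OF compact_imp_closed[OF K(1)] K(2) s0 _ \<epsilon>(1) ne] s'(1) by auto
  have "ereal s \<le> BK_entropy \<mu> f \<alpha> \<phi>"
    by (intro BK_entropy_ge local_BK_entropy_ge[OF \<mu>(1,2) \<epsilon>(1) \<mu>(4) \<mu>(5)] \<mu>(1) s0)
  also have "\<dots> \<le> ?R" using \<mu> by (intro SUP_upper) auto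
  finally show False using s(1) by simp
qed

subsection \<open>Mass distribution\<close>

text \<open>Points of a common ball of radius \<open>d / 2\<close> have orbits less than
  \<open>d\<close> apart up to time \<open>n\<close>, so uniform continuity costs at most
  \<open>\<eta>\<close> per step.\<close>

lemma S_sup_le_perturbed:
  fixes \<eta> :: real
  assumes "0 < \<eta>"
  obtains \<rho> where "0 < \<rho>" "\<And>n x y. y \<in> B n x \<rho> \<Longrightarrow> S_sup n x \<rho> \<le> S n y + n * \<eta>"
proof -
  have "uniformly_continuous_on UNIV \<phi>"
    by (rule compact_uniformly_continuous[OF continuous_phi compact_UNIV])
  then obtain d where d: "0 < d" "\<And>u v. dist v u < d \<Longrightarrow> dist (\<phi> v) (\<phi> u) < \<eta>"
    using assms unfolding uniformly_continuous_on_def by auto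
  have "S_sup n x (d / 2) \<le> S n y + n * \<eta>" if y: "y \<in> B n x (d / 2)" for n x y
    unfolding S_sup_def
  proof (rule cSUP_least)
    show "B n x (d / 2) \<noteq> {}" using y by blast
    fix z assume z: "z \<in> B n x (d / 2)"
    have "\<phi> ((f ^^ j) z) \<le> \<phi> ((f ^^ j) y) + \<eta>" if "j < n" for j
    proof -
      have "dist ((f ^^ j) z) ((f ^^ j) y) < d"
        using mem_B_dist[OF y that] mem_B_dist[OF z that]
          dist_triangle3[of "(f ^^ j) z" "(f ^^ j) y" "(f ^^ j) x"] by linarith
      from d(2)[OF this] show ?thesis by (simp add: dist_real_def)
    qed
    then have "S n z \<le> (\<Sum>j<n. \<phi> ((f ^^ j) y) + \<eta>)"
      unfolding birkhoff_sum_def by (intro sum_mono) auto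
    then show "S n z \<le> S n y + n * \<eta>" by (simp add: birkhoff_sum_def sum.distrib)
  qed
  then show ?thesis using d(1) by (intro that[of "d / 2"]) auto
qed

text \<open>The mass distribution principle for a possibly non-measurable set \<open>A\<close>: its
  mass is replaced by a lower bound \<open>d\<close> for all open supersets.\<close>

lemma M_alpha_n_ge_mass:
  assumes sets: "sets \<mu> = sets borel" and "A \<subseteq> K"
    and mass: "\<And>U. open U \<Longrightarrow> A \<subseteq> U \<Longrightarrow> d \<le> emeasure \<mu> U"
    and ball: "\<And>n x y. N \<le> n \<Longrightarrow> y \<in> A \<Longrightarrow> y \<in> B n x \<rho> \<Longrightarrow>
      emeasure \<mu> (B n x \<rho>) \<le> ennreal (exp (- s * S_sup n x \<rho>))"
  shows "d \<le> M_alpha_n f \<alpha> K s \<rho> N \<phi>"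
proof (rule M_alpha_n_greatest)
  fix I :: "nat set" and x m
  assume m: "\<forall>i\<in>I. N \<le> m i" and cover: "K \<subseteq> (\<Union>i\<in>I. B (m i) (x i) \<rho>)"
  let ?b = "\<lambda>i. B (m i) (x i) \<rho>"
  \<comment> \<open>Balls that miss \<open>A\<close> are emptied, since \<open>ball\<close> bounds
    the measure only of balls meeting \<open>A\<close>.\<close>
  define V where "V i = (if i \<in> I \<and> ?b i \<inter> A \<noteq> {} then ?b i else {})" for i
  have V: "open (V i)" for i by (simp add: V_def open_B)
  have "A \<subseteq> (\<Union>i. V i)"
  proof
    fix a assume "a \<in> A"
    then obtain i where "i \<in> I" "a \<in> ?b i" using cover \<open>A \<subseteq> K\<close> by blast
    then have "a \<in> V i" using \<open>a \<in> A\<close> by (auto simp: V_def)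
    then show "a \<in> (\<Union>i. V i)" by blast
  qed
  then have "d \<le> emeasure \<mu> (\<Union>i. V i)" using V by (intro mass) auto
  also have "\<dots> \<le> (\<Sum>i. emeasure \<mu> (V i))"
    using V sets by (intro emeasure_subadditive_countably) auto
  also have "\<dots> = (\<integral>\<^sup>+ i. emeasure \<mu> (V i) \<partial>count_space UNIV)"
    by (simp add: nn_integral_count_space_nat)
  also have "\<dots> \<le> (\<integral>\<^sup>+ i. ennreal (exp (- s * S_sup (m i) (x i) \<rho>)) * indicator I i \<partial>count_space UNIV)"
  proof (rule nn_integral_mono)
    fix i
    show "emeasure \<mu> (V i) \<le> ennreal (exp (- s * S_sup (m i) (x i) \<rho>)) * indicator I i"
    proof (cases "i \<in> I \<and> ?b i \<inter> A \<noteq> {}")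
      case True
      then obtain y where "y \<in> A" "y \<in> ?b i" by blast
      then show ?thesis using ball[of "m i" y "x i"] m True by (simp add: V_def)
    qed (auto simp: V_def)
  qed
  also have "\<dots> = (\<integral>\<^sup>+ i. ennreal (exp (- s * S_sup (m i) (x i) \<rho>)) \<partial>count_space I)"
    by (simp add: nn_integral_count_space_indicator)
  finally show "d \<le> (\<integral>\<^sup>+ i. ennreal (exp (- s * (SUP y \<in> B (m i) (x i) \<rho>. S (m i) y))) \<partial>count_space I)"
    unfolding S_sup_def .
qed

lemma measure_le_of_local_BK_ratio:
  assumes "1 \<le> n" "ereal s < local_BK_ratio \<mu> f \<alpha> \<phi> y \<epsilon> n"
  shows "measure \<mu> (B n y \<epsilon>) \<le> exp (- s * S n y)"
proof (cases "measure \<mu> (B n y \<epsilon>) = 0")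
  case False
  then have p: "0 < measure \<mu> (B n y \<epsilon>)" by (simp add: zero_less_measure_iff)
  have "0 < phi_min * n" using assms(1) phi_min_pos by simp
  then have "0 < S n y" using S_ge[of n y] by linarith
  moreover have "s < - ln (measure \<mu> (B n y \<epsilon>)) / S n y"
    using assms(2) False by (simp add: local_BK_ratio_def)
  ultimately have "s * S n y < - ln (measure \<mu> (B n y \<epsilon>))"
    by (metis pos_less_divide_eq)
  then have "ln (measure \<mu> (B n y \<epsilon>)) \<le> - s * S n y" by simp
  then show ?thesis using p by (metis exp_le_cancel_iff exp_ln)
qed simp

text \<open>A ball of radius \<open>\<rho>\<close> meeting \<open>A\<close> at \<open>y\<close> lies
  in \<open>B n y \<epsilon>\<close>, whose mass is at most \<open>exp (- s * S n y)\<close>.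
  Passing from \<open>S n y\<close> to \<open>S_sup\<close> costs up to \<open>n * \<eta>\<close>,
  which the drop from \<open>s\<close> to \<open>s'\<close> pays for.\<close>

lemma dim_BS_alpha_ge_local:
  assumes \<mu>: "prob_space \<mu>" "sets \<mu> = sets borel" and "A \<subseteq> K"
    and mass: "0 < d" "\<And>U. open U \<Longrightarrow> A \<subseteq> U \<Longrightarrow> d \<le> emeasure \<mu> U"
    and \<epsilon>: "0 < \<epsilon>" and s: "0 \<le> s'" "s' < s"
    and ratio: "\<And>n y. y \<in> A \<Longrightarrow> N \<le> n \<Longrightarrow> ereal s < local_BK_ratio \<mu> f \<alpha> \<phi> y \<epsilon> n"
  shows "ereal s' \<le> dim_BS_alpha f \<alpha> K \<phi>"
proof -
  interpret prob_space \<mu> by fact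
  \<comment> \<open>Chosen so that \<open>s' * \<eta> \<le> (s - s') * phi_min\<close>; the
    denominator \<open>s' + 1\<close> also covers \<open>s' = 0\<close>.\<close>
  define \<eta> where "\<eta> = (s - s') * phi_min / (s' + 1)"
  have \<eta>: "0 < \<eta>" using s phi_min_pos by (simp add: \<eta>_def)
  have "s' * \<eta> \<le> (s' + 1) * \<eta>" using \<eta> by (intro mult_right_mono) auto
  also have "\<dots> = (s - s') * phi_min" using s by (simp add: \<eta>_def)
  finally have s'\<eta>: "s' * \<eta> \<le> (s - s') * phi_min" .
  obtain \<rho>0 where \<rho>0: "0 < \<rho>0" "\<And>n x y. y \<in> B n x \<rho>0 \<Longrightarrow> S_sup n x \<rho>0 \<le> S n y + n * \<eta>"
    by (rule S_sup_le_perturbed[OF \<eta>]) blast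
  define \<rho> where "\<rho> = min \<rho>0 (\<epsilon> / 2)"
  have \<rho>: "0 < \<rho>" "\<rho> \<le> \<rho>0" "2 * \<rho> \<le> \<epsilon>" using \<rho>0(1) \<epsilon> by (auto simp: \<rho>_def)
  \<comment> \<open>Treating all exponents up to \<open>s'\<close> at once shows directly that every
    \<open>t\<close> in the infimum defining \<open>M_alpha_eps\<close> exceeds
    \<open>s'\<close>.\<close>
  have pos: "M_alpha_s f \<alpha> K s'' \<rho> \<phi> \<noteq> 0" if s'': "0 \<le> s''" "s'' \<le> s'" for s''
  proof -
    \<comment> \<open>Orders start at 1 at least, since the ratio controls the measure of the ball
      only when \<open>S n y\<close> is positive.\<close>
    have "d \<le> M_alpha_n f \<alpha> K s'' \<rho> (max N 1) \<phi>"
    proof (rule M_alpha_n_ge_mass[OF \<mu>(2) \<open>A \<subseteq> K\<close> mass(2)])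
      fix n x y assume n: "max N 1 \<le> n" and y: "y \<in> A" "y \<in> B n x \<rho>"
      have y0: "y \<in> B n x \<rho>0" using y(2) B_mono[OF \<rho>(2)] by blast
      have "B n x \<rho> \<subseteq> B n y \<epsilon>"
        using B_subset_double[OF y(2)] B_mono[OF \<rho>(3)] by blast
      then have "measure \<mu> (B n x \<rho>) \<le> measure \<mu> (B n y \<epsilon>)"
        using \<mu>(2) by (intro finite_measure_mono) (auto simp: open_B)
      also have "\<dots> \<le> exp (- s * S n y)"
        using n ratio[OF y(1)] by (intro measure_le_of_local_BK_ratio) auto
      also have "\<dots> \<le> exp (- s'' * S_sup n x \<rho>)"
      proof -
        have "S_sup n x \<rho> \<le> S n y + n * \<eta>"
          using S_sup_mono[OF \<rho>(1) B_mono[OF \<rho>(2)], of n x] \<rho>0(2)[OF y0] by linarith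
        moreover have "0 \<le> S_sup n x \<rho>"
          using S_sup_ge[OF \<rho>(1), of n x] phi_min_pos
          by (meson less_imp_le mult_nonneg_nonneg of_nat_0_le_iff order_trans)
        ultimately have "s'' * S_sup n x \<rho> \<le> s' * (S n y + n * \<eta>)"
          using s'' by (intro mult_mono) auto
        also have "\<dots> \<le> s * S n y"
        proof -
          have "n * (s' * \<eta>) \<le> n * ((s - s') * phi_min)" by (intro mult_left_mono s'\<eta>) auto
          also have "\<dots> = (s - s') * (phi_min * n)" by simp
          also have "\<dots> \<le> (s - s') * S n y" using s by (intro mult_left_mono S_ge) auto
          finally show ?thesis by (simp add: algebra_simps)
        qed
        finally show ?thesis by simp
      qed
      finally show "emeasure \<mu> (B n x \<rho>) \<le> ennreal (exp (- s'' * S_sup n x \<rho>))"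
        by (simp add: emeasure_eq_measure ennreal_leI)
    qed
    also have "\<dots> \<le> M_alpha_s f \<alpha> K s'' \<rho> \<phi>"
      unfolding M_alpha_s_eq_SUP by (rule SUP_upper) simp
    finally show ?thesis using mass(1) by auto
  qed
  have "ereal s' \<le> M_alpha_eps f \<alpha> K \<rho> \<phi>"
    unfolding M_alpha_eps_def
  proof (rule Inf_greatest, clarify)
    fix t :: real assume "0 \<le> t" "M_alpha_s f \<alpha> K t \<rho> \<phi> = 0"
    then have "\<not> t \<le> s'" using pos by blast
    then show "ereal s' \<le> ereal t" by simp
  qed
  also have "\<dots> \<le> dim_BS_alpha f \<alpha> K \<phi>"
    unfolding dim_BS_alpha_eq_SUP using \<rho>(1) by (intro SUP_upper) simp
  finally show ?thesis .
qed

section \<open>Exceptional sets and the lower bound on the dimension\<close>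

lemma local_BK_entropy_gtD:
  assumes \<mu>: "prob_space \<mu>" "sets \<mu> = sets borel" and "ereal s < local_BK_entropy \<mu> f \<alpha> \<phi> x"
  obtains k N :: nat where "\<And>n. N \<le> n \<Longrightarrow> ereal s < local_BK_ratio \<mu> f \<alpha> \<phi> x (1 / Suc k) n"
proof -
  obtain \<epsilon> where \<epsilon>: "0 < \<epsilon>" "ereal s < liminf (local_BK_ratio \<mu> f \<alpha> \<phi> x \<epsilon>)"
    using assms(3) by (auto simp: local_BK_entropy_eq_SUP[OF \<mu>] less_SUP_iff)
  \<comment> \<open>Shrinking the radius to some \<open>1 / Suc k\<close> leaves only countably many
    pairs \<open>(k, N)\<close>, so that null sets can be united later.\<close>
  obtain k :: nat where k: "1 / Suc k < \<epsilon>"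
    using reals_Archimedean[OF \<epsilon>(1)] by (auto simp: inverse_eq_divide)
  have "\<forall>\<^sub>F n in sequentially. ereal s < local_BK_ratio \<mu> f \<alpha> \<phi> x \<epsilon> n"
    by (rule less_LiminfD[OF \<epsilon>(2)])
  then obtain N where N: "\<And>n. N \<le> n \<Longrightarrow> ereal s < local_BK_ratio \<mu> f \<alpha> \<phi> x \<epsilon> n"
    by (auto simp: eventually_sequentially)
  show ?thesis
  proof (rule that)
    fix n assume "N \<le> n"
    then show "ereal s < local_BK_ratio \<mu> f \<alpha> \<phi> x (1 / Suc k) n"
      using N local_BK_ratio_antimono[OF \<mu>, of "1 / Suc k" \<epsilon> x n] k
      by (meson less_imp_le less_le_trans)
  qed
qed

text \<open>With \<open>s'\<close> and \<open>s\<close> strictly between the dimension and the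
  entropy, \<open>dim_BS_alpha_ge_local\<close> forces each piece of the set of local entropy above
  \<open>s\<close> into a null set. Then the local entropy is at most \<open>s\<close> almost
  everywhere, and so is its integral.\<close>

lemma BK_entropy_le_dim:
  assumes \<mu>: "prob_space \<mu>" "sets \<mu> = sets borel" and K: "measure \<mu> K = 1"
  shows "BK_entropy \<mu> f \<alpha> \<phi> \<le> dim_BS_alpha f \<alpha> K \<phi>"
proof (rule ccontr)
  interpret prob_space \<mu> by fact
  assume "\<not> ?thesis"
  then have "dim_BS_alpha f \<alpha> K \<phi> < BK_entropy \<mu> f \<alpha> \<phi>" by simp
  then obtain s where s: "dim_BS_alpha f \<alpha> K \<phi> < ereal s" "ereal s < BK_entropy \<mu> f \<alpha> \<phi>"
    using ereal_dense2 by blast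
  obtain s' where s': "dim_BS_alpha f \<alpha> K \<phi> < ereal s'" "ereal s' < ereal s"
    using ereal_dense2[OF s(1)] by blast
  \<comment> \<open>Nonnegativity of the dimension makes \<open>s'\<close> and \<open>s\<close>
    positive, so both are admissible exponents and \<open>s\<close> survives the passage to
    \<open>ennreal\<close>.\<close>
  have "0 \<le> M_alpha_eps f \<alpha> K 1 \<phi>" by (rule M_alpha_eps_nonneg)
  also have "\<dots> \<le> dim_BS_alpha f \<alpha> K \<phi>"
    unfolding dim_BS_alpha_eq_SUP by (intro SUP_upper) simp
  finally have "0 < ereal s'" using s'(1) by (rule le_less_trans)
  then have s'0: "0 \<le> s'" "s' < s" "0 \<le> s" using s'(2) by auto
  \<comment> \<open>The set where the local entropy exceeds \<open>s\<close> is covered by countably many sets \<open>Q p\<close>. Comparing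
    with open supersets instead of measuring \<open>Q p\<close> avoids any measurability question.\<close>
  define Q where "Q p = {x \<in> K. \<forall>n\<ge>snd p. ereal s < local_BK_ratio \<mu> f \<alpha> \<phi> x (1 / real (Suc (fst p))) n}"
    for p :: "nat \<times> nat"
  have "\<exists>G. G \<in> null_sets \<mu> \<and> Q p \<subseteq> G" for p
  proof (rule ccontr)
    assume no: "\<nexists>G. G \<in> null_sets \<mu> \<and> Q p \<subseteq> G"
    have "\<exists>d::ennreal. 0 < d \<and> (\<forall>U. open U \<longrightarrow> Q p \<subseteq> U \<longrightarrow> d \<le> emeasure \<mu> U)"
    proof (rule ccontr)
      assume neg: "\<not> ?thesis"
      have "\<exists>U. open U \<and> Q p \<subseteq> U \<and> emeasure \<mu> U < d" if "0 < d" for d :: ennreal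
        using neg that by (meson not_less)
      from subset_null_set_of_small_open[OF \<mu>(2) this] no show False by blast
    qed
    then obtain d :: ennreal where d: "0 < d" "\<And>U. open U \<Longrightarrow> Q p \<subseteq> U \<Longrightarrow> d \<le> emeasure \<mu> U"
      by blast
    have "ereal s' \<le> dim_BS_alpha f \<alpha> K \<phi>"
      by (rule dim_BS_alpha_ge_local[where \<epsilon> = "1 / real (Suc (fst p))" and s = s and N = "snd p", OF \<mu> _ d])
        (use s'0 in \<open>auto simp: Q_def\<close>)
    with s'(1) show False by simp
  qed
  then have "\<exists>G. \<forall>p. G p \<in> null_sets \<mu> \<and> Q p \<subseteq> G p" by (intro choice allI)
  then obtain G where "\<forall>p. G p \<in> null_sets \<mu> \<and> Q p \<subseteq> G p" ..
  then have G: "\<And>p. G p \<in> null_sets \<mu>" "\<And>p. Q p \<subseteq> G p" by auto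
  have "(\<Union>p. G p) \<in> null_sets \<mu>" using G(1) by (intro null_sets_UN') auto
  then have "AE x in \<mu>. x \<notin> (\<Union>p. G p)" by (rule AE_not_in)
  moreover have "AE x in \<mu>. x \<in> K" by (rule AE_prob_1[OF K])
  ultimately have "AE x in \<mu>. e2ennreal (local_BK_entropy \<mu> f \<alpha> \<phi> x) \<le> ennreal s"
  proof eventually_elim
    case (elim x)
    have "local_BK_entropy \<mu> f \<alpha> \<phi> x \<le> ereal s"
    proof (rule ccontr)
      assume "\<not> ?thesis"
      then have "ereal s < local_BK_entropy \<mu> f \<alpha> \<phi> x" by simp
      from local_BK_entropy_gtD[OF \<mu> this] obtain k N :: nat where
        "\<And>n. N \<le> n \<Longrightarrow> ereal s < local_BK_ratio \<mu> f \<alpha> \<phi> x (1 / Suc k) n" by blast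
      then have "x \<in> Q (k, N)" using elim by (simp add: Q_def)
      then show False using G(2) elim by blast
    qed
    from e2ennreal_mono[OF this] show ?case using s'0 by (simp add: e2ennreal_ereal_nonneg)
  qed
  then have "(\<integral>\<^sup>+ x. e2ennreal (local_BK_entropy \<mu> f \<alpha> \<phi> x) \<partial>\<mu>) \<le> (\<integral>\<^sup>+ x. ennreal s \<partial>\<mu>)"
    by (rule nn_integral_mono_AE)
  then have "BK_entropy \<mu> f \<alpha> \<phi> \<le> ereal s"
    using s'0 by (simp add: BK_entropy_def less_eq_ennreal.rep_eq enn2ereal_ennreal emeasure_space_1)
  with s(2) show False by simp
qed

end

theorem theorem1p2:
  fixes f :: "'a::metric_space \<Rightarrow> 'a" and \<phi> :: "'a \<Rightarrow> real"
    and K :: "'a set" and \<alpha> :: real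
  assumes "compact (UNIV :: 'a set)"
    and "continuous_on UNIV f"
    and "continuous_on UNIV \<phi>" and "\<forall>x. 0 < \<phi> x"
    and "compact K" and "K \<noteq> {}"
    and "0 \<le> \<alpha>"
  shows "dim_BS_alpha f \<alpha> K \<phi> =
    (SUP \<mu> \<in> {\<mu> :: 'a measure. prob_space \<mu> \<and> sets \<mu> = sets borel \<and> measure \<mu> K = 1}.
        BK_entropy \<mu> f \<alpha> \<phi>)"
proof -
  interpret alpha_system f \<phi> \<alpha>
    using assms by unfold_locales auto
  show ?thesis
    by (intro antisym dim_BS_alpha_le SUP_least assms) (auto intro: BK_entropy_le_dim)
qed

end
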